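(* Let $K$ be a field, $S=K[x_1,\dots,x_n]$ the standard graded polynomial ring, and let $I=(f_1,\dots,f_p)\subset S$ be a graded proper ideal generated by a regular sequence $f_1,\dots,f_p$ ($p\ge 1$) of homogeneous polynomials. Let $R=S/I$ (a complete intersection, with $\operatorname{proj\,dim}_S(R)=p$), and let $\beta_i^S(R)$, $M_i$, $m_i$ be its total Betti numbers and maximal and minimal shifts. Then: (i) For $i=1,\dots,p$, $$ \beta_i^S(R)\leq \prod_{1\leq j<i}\frac{M_j}{M_i-M_j}\cdot\prod_{i<j\leq p}\frac{M_j}{M_j-M_i}\leq \frac{1}{(i-1)!\,(p-i)!}\prod_{1\le j\le p,\ j\neq i}M_j . $$ Moreover, $\beta_i^S(R)$ equals the first upper bound for all $i=1,\dots,p$ if and only if $R$ has a pure resolution; and $\beta_i^S(R)$ equals both upper bounds for all $i=1,\dots,p$ if and only if $I$ has a linear resolution. (ii) For $i=1,\dots,p$, $$ \beta_i^S(R)\geq \prod_{1\leq j<i}\frac{m_j}{m_i-m_j}\cdot\prod_{i<j\leq p}\frac{m_j}{m_j-m_i}\geq \prod_{1\leq j<i}\frac{m_j}{M_i-m_j}\cdot\prod_{i<j\leq p}\frac{m_j}{M_j-m_i}. $$ Moreover, $\beta_i^S(R)$ equals both lower bounds for all $i=1,\dots,p$ if and only if $R$ has a pure resolution.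
   Context: $S=K[x_1,\dots,x_n]$ is graded by $\deg(x_i)=1$. For a finitely generated graded $S$-module $N$, $\beta^S_{i,j}(N)=\dim_K\operatorname{Tor}^S_i(N,K)_j$ are the graded Betti numbers and $\beta^S_i(N)=\sum_{j\in\mathbb{Z}}\beta^S_{i,j}(N)$ the total Betti numbers. For $R=S/I$ with $p=\operatorname{proj\,dim}_S(R)$ and $1\le i\le p$, set $M_i=\max\{j\in\mathbb{Z}:\beta^S_{i,j}(R)\neq 0\}$ and $m_i=\min\{j\in\mathbb{Z}:\beta^S_{i,j}(R)\neq 0\}$. $R$ has a pure resolution if for each $i=1,\dots,p$ there is exactly one $j$ with $\beta^S_{i,j}(R)\ne 0$ (i.e. $m_i=M_i$). $I$ has a linear resolution if for some integer $k$ one has $\beta^S_{i,i+j}(I)=0$ for all $i$ and all $j\neq k$. Empty products are $1$. *)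

theory Defs
  imports Complex_Main "HOL-Library.Poly_Mapping" "HOL-Library.Function_Algebras"
begin

(* S = K[x_v : v in 'n], as finitely supported functions from exponent vectors to
   coefficients, with the library's convolution product; n = CARD('n). *)
type_synonym ('n, 'k) mpoly = "('n \<Rightarrow>\<^sub>0 nat) \<Rightarrow>\<^sub>0 'k"

definition mon_degree :: "('n::finite \<Rightarrow>\<^sub>0 nat) \<Rightarrow> nat" where
  "mon_degree m = (\<Sum>v\<in>UNIV. Poly_Mapping.lookup m v)"

(* Zero is homogeneous of every degree, and the only homogeneous element of negative degree. *)
definition homogeneous :: "int \<Rightarrow> ('n::finite, 'k::field) mpoly \<Rightarrow> bool" where
  "homogeneous d f \<longleftrightarrow> (\<forall>m\<in>Poly_Mapping.keys f. int (mon_degree m) = d)"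

definition ideal_of :: "('n, 'k::field) mpoly set \<Rightarrow> ('n, 'k) mpoly set" where
  "ideal_of B = module.span (*) B"

definition graded_ideal :: "('n::finite, 'k::field) mpoly set \<Rightarrow> bool" where
  "graded_ideal J \<longleftrightarrow> (\<exists>B. (\<forall>b\<in>B. \<exists>d. homogeneous d b) \<and> J = ideal_of B)"

definition regular_sequence :: "('n, 'k::field) mpoly list \<Rightarrow> bool" where
  "regular_sequence fs \<longleftrightarrow>
     (\<forall>i<length fs. \<forall>g. g * fs ! i \<in> ideal_of (set (take i fs)) \<longrightarrow>
                        g \<in> ideal_of (set (take i fs))) \<and>
     ideal_of (set fs) \<noteq> UNIV"

(* Free modules of rank r are functions on nat vanishing outside {..<r}; the s x r matrix A
   maps rank r to rank s. *)
definition free_mod :: "nat \<Rightarrow> (nat \<Rightarrow> 'a::comm_ring_1) set" where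
  "free_mod r = {v. \<forall>b\<ge>r. v b = 0}"

definition mat_map :: "nat \<Rightarrow> nat \<Rightarrow> (nat \<Rightarrow> nat \<Rightarrow> 'a::comm_ring_1) \<Rightarrow> (nat \<Rightarrow> 'a) \<Rightarrow> nat \<Rightarrow> 'a" where
  "mat_map r s A v = (\<lambda>a. if a < s then \<Sum>b<r. A a b * v b else 0)"

(* A sequence ... -> F_2 -> F_1 -> F_0 of finite graded free S-modules with an augmentation of F_0:
   F_i is the sum of S(- gen_deg F i b) over b < free_rank F i, the matrix dmat F i represents
   F_(i+1) -> F_i, and aug F b represents the image of the b-th basis element of F_0.  The ring 's is always S here. *)
record 's free_cpx =
  free_rank :: "nat \<Rightarrow> nat"
  gen_deg :: "nat \<Rightarrow> nat \<Rightarrow> int"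
  dmat :: "nat \<Rightarrow> nat \<Rightarrow> nat \<Rightarrow> 's"
  aug :: "nat \<Rightarrow> 's"

definition cpx_diff :: "('n, 'k::field) mpoly free_cpx \<Rightarrow> nat \<Rightarrow>
    (nat \<Rightarrow> ('n, 'k) mpoly) \<Rightarrow> nat \<Rightarrow> ('n, 'k) mpoly" where
  "cpx_diff F i = mat_map (free_rank F (Suc i)) (free_rank F i) (dmat F i)"

definition cpx_aug :: "('n, 'k::field) mpoly free_cpx \<Rightarrow> (nat \<Rightarrow> ('n, 'k) mpoly) \<Rightarrow> ('n, 'k) mpoly" where
  "cpx_aug F v = (\<Sum>b<free_rank F 0. aug F b * v b)"

(* Graded modules are given as quotients U/V of graded ideals V \<subseteq> U of S: R = S/I is UNIV/I,
   and I itself is I/{0}.  The last three conjuncts are exactness of ... -> F_1 -> F_0 -> U/V -> 0. *)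
definition graded_free_resolution ::
    "('n::finite, 'k::field) mpoly free_cpx \<Rightarrow> ('n, 'k) mpoly set \<Rightarrow> ('n, 'k) mpoly set \<Rightarrow> bool" where
  "graded_free_resolution F U V \<longleftrightarrow>
     graded_ideal U \<and> graded_ideal V \<and> V \<subseteq> U \<and>
     (\<forall>b<free_rank F 0. aug F b \<in> U \<and> homogeneous (gen_deg F 0 b) (aug F b)) \<and>
     (\<forall>i. \<forall>a<free_rank F i. \<forall>b<free_rank F (Suc i).
        homogeneous (gen_deg F (Suc i) b - gen_deg F i a) (dmat F i a b)) \<and>
     (\<forall>u\<in>U. \<exists>v\<in>free_mod (free_rank F 0). u - cpx_aug F v \<in> V) \<and>
     {v \<in> free_mod (free_rank F 0). cpx_aug F v \<in> V} =
        cpx_diff F 0 ` free_mod (free_rank F 1) \<and>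
     (\<forall>i. {v \<in> free_mod (free_rank F (Suc i)). cpx_diff F i v = (\<lambda>_. 0)} =
        cpx_diff F (Suc i) ` free_mod (free_rank F (Suc (Suc i))))"

(* The complex F \<otimes>\<^sub>S K with K = S/(x_v : v): the basis is kept and every matrix entry is replaced
   by its constant coefficient.  Only the strand of internal degree j is considered. *)
definition tensor_mod :: "('n, 'k::field) mpoly free_cpx \<Rightarrow> nat \<Rightarrow> int \<Rightarrow> (nat \<Rightarrow> 'k) set" where
  "tensor_mod F i j = {v \<in> free_mod (free_rank F i). \<forall>b. v b \<noteq> 0 \<longrightarrow> gen_deg F i b = j}"

definition tensor_diff :: "('n, 'k::field) mpoly free_cpx \<Rightarrow> nat \<Rightarrow> (nat \<Rightarrow> 'k) \<Rightarrow> nat \<Rightarrow> 'k" where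
  "tensor_diff F i =
     mat_map (free_rank F (Suc i)) (free_rank F i) (\<lambda>a b. Poly_Mapping.lookup (dmat F i a b) 0)"

definition tensor_cycles :: "('n, 'k::field) mpoly free_cpx \<Rightarrow> nat \<Rightarrow> int \<Rightarrow> (nat \<Rightarrow> 'k) set" where
  "tensor_cycles F i j =
     (case i of 0 \<Rightarrow> tensor_mod F 0 j
      | Suc i' \<Rightarrow> {v \<in> tensor_mod F (Suc i') j. tensor_diff F i' v = (\<lambda>_. 0)})"

definition tensor_boundaries :: "('n, 'k::field) mpoly free_cpx \<Rightarrow> nat \<Rightarrow> int \<Rightarrow> (nat \<Rightarrow> 'k) set" where
  "tensor_boundaries F i j = tensor_diff F i ` tensor_mod F (Suc i) j"

definition vec_dim :: "(nat \<Rightarrow> 'k::field) set \<Rightarrow> nat" where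
  "vec_dim = vector_space.dim (\<lambda>c v b. c * v b)"

definition homology_dim :: "('n, 'k::field) mpoly free_cpx \<Rightarrow> nat \<Rightarrow> int \<Rightarrow> nat" where
  "homology_dim F i j = vec_dim (tensor_cycles F i j) - vec_dim (tensor_boundaries F i j)"

(* The graded Betti number dim_K Tor_i(U/V, K)_j, computed from some graded free resolution of U/V;
   Tor does not depend on the choice. *)
definition betti :: "nat \<Rightarrow> int \<Rightarrow> ('n::finite, 'k::field) mpoly set \<Rightarrow> ('n, 'k) mpoly set \<Rightarrow> nat" where
  "betti i j U V = homology_dim (SOME F. graded_free_resolution F U V) i j"

definition total_betti :: "nat \<Rightarrow> ('n::finite, 'k::field) mpoly set \<Rightarrow> ('n, 'k) mpoly set \<Rightarrow> nat" where
  "total_betti i U V = (\<Sum>j\<in>{j. betti i j U V \<noteq> 0}. betti i j U V)"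

definition max_shift :: "nat \<Rightarrow> ('n::finite, 'k::field) mpoly set \<Rightarrow> ('n, 'k) mpoly set \<Rightarrow> int" where
  "max_shift i U V = Max {j. betti i j U V \<noteq> 0}"

definition min_shift :: "nat \<Rightarrow> ('n::finite, 'k::field) mpoly set \<Rightarrow> ('n, 'k) mpoly set \<Rightarrow> int" where
  "min_shift i U V = Min {j. betti i j U V \<noteq> 0}"

(* The least length of a graded free resolution; for finitely generated graded S-modules this is
   the projective dimension over S. *)
definition proj_dim :: "('n::finite, 'k::field) mpoly set \<Rightarrow> ('n, 'k) mpoly set \<Rightarrow> nat" where
  "proj_dim U V =
     (LEAST q. \<exists>F. graded_free_resolution F U V \<and> (\<forall>i>q. free_rank F i = 0))"

definition pure_resolution :: "('n::finite, 'k::field) mpoly set \<Rightarrow> ('n, 'k) mpoly set \<Rightarrow> bool" where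
  "pure_resolution U V \<longleftrightarrow> (\<forall>i\<in>{1..proj_dim U V}. \<exists>!j. betti i j U V \<noteq> 0)"

definition linear_resolution :: "('n::finite, 'k::field) mpoly set \<Rightarrow> ('n, 'k) mpoly set \<Rightarrow> bool" where
  "linear_resolution U V \<longleftrightarrow> (\<exists>k::int. \<forall>i j. j \<noteq> k \<longrightarrow> betti i (int i + j) U V = 0)"

end

(* Up to homotopy there is only one chain map between two graded free resolutions, so after reduction
   modulo the variables all of them have homology of the same dimension, and the Betti numbers can be
   read off from any minimal resolution.  Adjoining the f_i one at a time, the mapping cone of
   multiplication by f_i resolves the next quotient and stays minimal; this is the Koszul resolution.
   Hence beta_{i,j} counts the i-element sets of generators of total degree j, so that beta_i = (p choose i),
   and M_i, m_i are the largest and smallest sums of i of the degrees.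

   Removing the smallest of i+1 degrees shows that M_i / i decreases, and M_{i+1} >= M_i + 1; dually for m_i.
   As (p choose i) is the product of the j / |i - j| over j different from i, all bounds hold factor by factor.
   For i = 1 equality forces M_p = p M_1 (or m_p = p m_1), i.e. that all degrees coincide. *)
theory Submission
  imports Defs
begin

subsection \<open>Homogeneous components of polynomials\<close>

text \<open>\<open>betti\<close> is computed from a resolution picked by \<open>SOME\<close>, so
  nothing can be read off the Koszul resolution before independence is known. One inequality of
  homology dimensions suffices for that, since the two resolutions can change roles. Exactness
  speaks of arbitrary elements, whereas chain maps and homotopies must preserve degrees in order to
  act on a single strand; passing to degree parts of lifts bridges this gap.

  Regularity has two uses. It makes the cone exact in position 1, and together with properness of
  the ideal it makes all degrees positive, on which both minimality and the growth of the shifts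
  rest.

  The Betti numbers of \<open>I\<close> come from the same resolution with \<open>F_0\<close>
  removed. If all degrees equal \<open>c\<close>, the second upper bound exceeds
  \<open>beta_i\<close> by the factor \<open>c ^ (p - 1)\<close>. This is 1 for \<open>c = 1\<close>
  and also for \<open>p = 1\<close>, in accordance with the fact that a principal ideal has a linear
  resolution in every degree.\<close>

interpretation pideal: module "(*) :: ('n, 'k::field) mpoly \<Rightarrow> _ \<Rightarrow> _"
  by unfold_locales (simp_all add: algebra_simps)

declare pideal.scale_scale [simp del] \<comment> \<open>would loop with commutativity of multiplication\<close>

lemma ideal_of_mult: "x \<in> ideal_of B \<Longrightarrow> c * x \<in> ideal_of B"
  unfolding ideal_of_def by (rule pideal.span_scale)

lemma ideal_of_zero: "0 \<in> ideal_of B"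
  unfolding ideal_of_def by (rule pideal.span_zero)

lemma ideal_of_add: "x \<in> ideal_of B \<Longrightarrow> y \<in> ideal_of B \<Longrightarrow> x + y \<in> ideal_of B"
  unfolding ideal_of_def by (rule pideal.span_add)

lemma ideal_of_diff: "x \<in> ideal_of B \<Longrightarrow> y \<in> ideal_of B \<Longrightarrow> x - y \<in> ideal_of B"
  unfolding ideal_of_def by (rule pideal.span_diff)

lemma ideal_of_sum: "(\<And>x. x \<in> A \<Longrightarrow> g x \<in> ideal_of B) \<Longrightarrow> sum g A \<in> ideal_of B"
  unfolding ideal_of_def by (rule pideal.span_sum)

lemma ideal_of_base: "x \<in> B \<Longrightarrow> x \<in> ideal_of B"
  unfolding ideal_of_def by (rule pideal.span_base)

lemma ideal_of_empty: "ideal_of {} = {0}"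
  unfolding ideal_of_def by simp

lemma ideal_of_insert_iff: "x \<in> ideal_of (insert f B) \<longleftrightarrow> (\<exists>k. x - k * f \<in> ideal_of B)"
  unfolding ideal_of_def by (rule pideal.span_breakdown_eq)

lemma ideal_of_mono: "A \<subseteq> B \<Longrightarrow> ideal_of A \<subseteq> ideal_of B"
  unfolding ideal_of_def by (rule pideal.span_mono)

lemma one_in_ideal_of: "1 \<in> ideal_of B \<Longrightarrow> ideal_of B = UNIV"
  using ideal_of_mult[of 1 B] by auto

text \<open>Degrees are integers because the degree \<open>d - e\<close> in
  \<open>hcomp_mult\<close> may be negative; the component is then an empty sum.\<close>

definition hcomp :: "int \<Rightarrow> ('n::finite, 'k::field) mpoly \<Rightarrow> ('n, 'k) mpoly" where
  "hcomp d f = (\<Sum>m\<in>{m \<in> Poly_Mapping.keys f. int (mon_degree m) = d}.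
     Poly_Mapping.single m (Poly_Mapping.lookup f m))"

lemma lookup_hcomp:
  "Poly_Mapping.lookup (hcomp d f) m =
     (if int (mon_degree m) = d then Poly_Mapping.lookup f m else 0)"
proof -
  have "Poly_Mapping.lookup (hcomp d f) m =
    (\<Sum>x\<in>{m \<in> Poly_Mapping.keys f. int (mon_degree m) = d}. if x = m then Poly_Mapping.lookup f m else 0)"
    unfolding hcomp_def lookup_sum by (rule sum.cong) (auto simp: lookup_single when_def)
  then show ?thesis
    by (auto simp: in_keys_iff)
qed

lemma hcomp_add: "hcomp d (f + g) = hcomp d f + hcomp d g"
  by (rule poly_mapping_eqI) (simp add: lookup_hcomp lookup_add)

lemma hcomp_diff: "hcomp d (f - g) = hcomp d f - hcomp d g"
  by (rule poly_mapping_eqI) (simp add: lookup_hcomp lookup_minus)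

lemma hcomp_zero: "hcomp d 0 = 0"
  by (rule poly_mapping_eqI) (simp add: lookup_hcomp)

lemma hcomp_sum: "hcomp d (sum g A) = (\<Sum>x\<in>A. hcomp d (g x))"
  by (rule poly_mapping_eqI) (simp add: lookup_hcomp lookup_sum)

lemma hcomp_single:
  "hcomp d (Poly_Mapping.single m c) = (if int (mon_degree m) = d then Poly_Mapping.single m c else 0)"
  by (rule poly_mapping_eqI) (auto simp: lookup_hcomp lookup_single when_def)

lemma homogeneous_lookup: "homogeneous d f \<longleftrightarrow> (\<forall>m. Poly_Mapping.lookup f m \<noteq> 0 \<longrightarrow> int (mon_degree m) = d)"
  unfolding homogeneous_def Ball_def lookup_not_eq_zero_eq_in_keys ..

lemma homogeneous_hcomp: "homogeneous d (hcomp d f)"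
  by (auto simp: homogeneous_lookup lookup_hcomp)

lemma hcomp_ident: "homogeneous d f \<Longrightarrow> hcomp d f = f"
  by (rule poly_mapping_eqI) (auto simp: homogeneous_lookup lookup_hcomp)

lemma homogeneous_zero: "homogeneous d 0"
  by (simp add: homogeneous_def)

text \<open>\<open>hcomp d\<close> is an additive projection onto the homogeneous elements of degree
  \<open>d\<close>, so it is enough to compute that it fixes \<open>f - g\<close>. The lemmas on
  sums and products use the same device.\<close>

lemma homogeneous_diff: "homogeneous d f \<Longrightarrow> homogeneous d g \<Longrightarrow> homogeneous d (f - g)"
  using homogeneous_hcomp[of d "f - g"] by (simp add: hcomp_diff hcomp_ident)

lemma homogeneous_uminus: "homogeneous d f \<Longrightarrow> homogeneous d (- f)"
  using homogeneous_diff[of d 0 f] by (simp add: homogeneous_zero)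

lemma homogeneous_sum: "(\<And>x. x \<in> A \<Longrightarrow> homogeneous d (g x)) \<Longrightarrow> homogeneous d (sum g A)"
  using homogeneous_hcomp[of d "sum g A"] by (simp add: hcomp_sum hcomp_ident)

lemma mpoly_monomials:
  "(f :: ('n, 'k::field) mpoly) = (\<Sum>m\<in>Poly_Mapping.keys f. Poly_Mapping.single m (Poly_Mapping.lookup f m))"
proof (rule poly_mapping_eqI)
  fix k
  have "(\<Sum>m\<in>Poly_Mapping.keys f. Poly_Mapping.lookup (Poly_Mapping.single m (Poly_Mapping.lookup f m)) k)
     = (\<Sum>m\<in>Poly_Mapping.keys f. if m = k then Poly_Mapping.lookup f k else 0)"
    by (rule sum.cong) (auto simp: lookup_single when_def)
  then show "Poly_Mapping.lookup f k =
      Poly_Mapping.lookup (\<Sum>m\<in>Poly_Mapping.keys f. Poly_Mapping.single m (Poly_Mapping.lookup f m)) k"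
    by (auto simp: lookup_sum in_keys_iff)
qed

lemma mult_monomials:
  "(f :: ('n, 'k::field) mpoly) * g = (\<Sum>a\<in>Poly_Mapping.keys f. \<Sum>b\<in>Poly_Mapping.keys g.
      Poly_Mapping.single (a + b) (Poly_Mapping.lookup f a * Poly_Mapping.lookup g b))"
proof -
  have "f * g = (\<Sum>a\<in>Poly_Mapping.keys f. Poly_Mapping.single a (Poly_Mapping.lookup f a)) *
      (\<Sum>b\<in>Poly_Mapping.keys g. Poly_Mapping.single b (Poly_Mapping.lookup g b))"
    by (simp only: mpoly_monomials[symmetric])
  then show ?thesis
    by (simp only: sum_product mult_single)
qed

lemma mon_degree_add: "mon_degree (a + b) = mon_degree a + mon_degree b"
  by (simp add: mon_degree_def lookup_add sum.distrib)

text \<open>On monomials this is additivity of \<open>mon_degree\<close>. It allows degree parts to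
  be taken entry by entry in a product of a homogeneous matrix with a vector.\<close>

lemma hcomp_mult:
  assumes "homogeneous e f"
  shows "hcomp d (f * g) = f * hcomp (d - e) g"
proof -
  define F where "F = (\<lambda>a. Poly_Mapping.single a (Poly_Mapping.lookup f a))"
  define G where "G = (\<lambda>b. Poly_Mapping.single b (Poly_Mapping.lookup g b))"
  have f: "f = sum F (Poly_Mapping.keys f)" and g: "g = sum G (Poly_Mapping.keys g)"
    unfolding F_def G_def by (rule mpoly_monomials)+
  have FG: "hcomp d (F a * G b) = F a * hcomp (d - e) (G b)" if "a \<in> Poly_Mapping.keys f" for a b
  proof -
    have "int (mon_degree a) = e"
      using assms that by (auto simp: homogeneous_def)
    then show ?thesis
      by (auto simp: F_def G_def mult_single hcomp_single mon_degree_add)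
  qed
  have "hcomp d (f * g) = hcomp d (sum F (Poly_Mapping.keys f) * sum G (Poly_Mapping.keys g))"
    by (simp only: f[symmetric] g[symmetric])
  also have "\<dots> = (\<Sum>a\<in>Poly_Mapping.keys f. \<Sum>b\<in>Poly_Mapping.keys g. F a * hcomp (d - e) (G b))"
    unfolding sum_product hcomp_sum by (intro sum.cong refl FG)
  also have "\<dots> = sum F (Poly_Mapping.keys f) * hcomp (d - e) (sum G (Poly_Mapping.keys g))"
    unfolding sum_product hcomp_sum ..
  also have "\<dots> = f * hcomp (d - e) g"
    by (simp only: f[symmetric] g[symmetric])
  finally show ?thesis .
qed

lemma homogeneous_mult:
  assumes "homogeneous d f" "homogeneous e g"
  shows "homogeneous (d + e) (f * g)"
  using homogeneous_hcomp[of "d + e" "f * g"] assms by (simp add: hcomp_mult hcomp_ident)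

lemma homogeneous_mult': "homogeneous d f \<Longrightarrow> homogeneous e g \<Longrightarrow> c = d + e \<Longrightarrow> homogeneous c (f * g)"
  by (simp add: homogeneous_mult)

lemma mon_degree_zero: "mon_degree 0 = 0"
  by (simp add: mon_degree_def)

lemma mon_degree_eq_0: "mon_degree m = 0 \<Longrightarrow> m = 0"
  by (rule poly_mapping_eqI) (simp add: mon_degree_def)

lemma homogeneous_one: "homogeneous 0 1"
  by (simp add: homogeneous_def mon_degree_zero)

text \<open>Only the zero exponents add up to zero, hence the constant coefficient is a ring
  homomorphism from \<open>S\<close> to \<open>K\<close>. The reduction modulo the variables rests
  on this.\<close>

lemma lookup_mult_zero:
  "Poly_Mapping.lookup ((f :: ('n::finite, 'k::field) mpoly) * g) 0 = Poly_Mapping.lookup f 0 * Poly_Mapping.lookup g 0"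
proof -
  have eq: "a + b = 0 \<longleftrightarrow> a = 0 \<and> b = 0" for a b :: "'n \<Rightarrow>\<^sub>0 nat"
    using mon_degree_add[of a b] mon_degree_eq_0[of a] mon_degree_eq_0[of b] by (auto simp: mon_degree_zero)
  have "Poly_Mapping.lookup (f * g) 0 = (\<Sum>a\<in>Poly_Mapping.keys f. \<Sum>b\<in>Poly_Mapping.keys g.
      Poly_Mapping.lookup (Poly_Mapping.single (a + b) (Poly_Mapping.lookup f a * Poly_Mapping.lookup g b)) 0)"
    by (subst mult_monomials) (simp add: lookup_sum)
  also have "\<dots> = (\<Sum>a\<in>Poly_Mapping.keys f. \<Sum>b\<in>Poly_Mapping.keys g.
      (if a = 0 then Poly_Mapping.lookup f 0 else 0) * (if b = 0 then Poly_Mapping.lookup g 0 else 0))"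
    by (intro sum.cong refl) (auto simp: lookup_single when_def eq)
  also have "\<dots> = (\<Sum>a\<in>Poly_Mapping.keys f. if a = 0 then Poly_Mapping.lookup f 0 else 0) *
      (\<Sum>b\<in>Poly_Mapping.keys g. if b = 0 then Poly_Mapping.lookup g 0 else 0)"
    by (simp only: sum_product)
  also have "\<dots> = Poly_Mapping.lookup f 0 * Poly_Mapping.lookup g 0"
    by (auto simp: in_keys_iff)
  finally show ?thesis .
qed

lemma homogeneous_lookup_zero: "homogeneous d f \<Longrightarrow> d \<noteq> 0 \<Longrightarrow> Poly_Mapping.lookup f 0 = 0"
  by (auto simp: homogeneous_lookup mon_degree_zero)

text \<open>A nonzero homogeneous element of degree at most 0 is a nonzero constant, hence a unit,
  which a proper ideal cannot contain.\<close>

lemma homogeneous_degree_pos: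
  assumes "homogeneous d f" "f \<noteq> 0" "f \<in> ideal_of B" "ideal_of B \<noteq> UNIV"
  shows "d > 0"
proof (rule ccontr)
  assume "\<not> d > 0"
  obtain m where m: "Poly_Mapping.lookup f m \<noteq> 0"
    using assms(2) by (metis lookup_zero poly_mapping_eqI)
  with assms(1) \<open>\<not> d > 0\<close> have "d = 0"
    by (auto simp: homogeneous_lookup)
  have f: "f = Poly_Mapping.single 0 (Poly_Mapping.lookup f 0)"
  proof (rule poly_mapping_eqI)
    fix k show "Poly_Mapping.lookup f k = Poly_Mapping.lookup (Poly_Mapping.single 0 (Poly_Mapping.lookup f 0)) k"
      using assms(1) \<open>d = 0\<close> mon_degree_eq_0[of k]
      by (cases "k = 0") (auto simp: homogeneous_lookup lookup_single when_def)
  qed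
  then have c: "Poly_Mapping.lookup f 0 \<noteq> 0"
    using assms(2) by auto
  have "Poly_Mapping.single 0 (inverse (Poly_Mapping.lookup f 0)) * f = 1"
    by (subst f) (simp add: mult_single c)
  with ideal_of_mult[OF assms(3)] have "1 \<in> ideal_of B"
    by metis
  with assms(4) one_in_ideal_of show False
    by blast
qed

text \<open>Keeps the error term of a lift inside the ideal when the lift is replaced by its degree
  part.\<close>

lemma graded_ideal_hcomp:
  assumes "graded_ideal J" "x \<in> J"
  shows "hcomp d x \<in> J"
proof -
  obtain B where B: "\<forall>b\<in>B. \<exists>d. homogeneous d b" "J = ideal_of B"
    using assms(1) by (auto simp: graded_ideal_def)
  have "x \<in> module.span (*) B"
    using assms(2) B(2) by (simp add: ideal_of_def)
  then have "hcomp d x \<in> ideal_of B"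
  proof (induction rule: pideal.span_induct_alt)
    case base
    show ?case by (simp add: hcomp_zero ideal_of_zero)
  next
    case (step c b y)
    obtain e where "homogeneous e b" using B(1) step(1) by auto
    then have "hcomp d (c * b) = hcomp (d - e) c * b"
      using hcomp_mult[of e b d c] by (simp add: mult.commute)
    then show ?case
      using step by (simp add: hcomp_add ideal_of_add ideal_of_mult ideal_of_base)
  qed
  then show ?thesis by (simp add: B(2))
qed

lemma graded_idealE:
  assumes "graded_ideal J"
  obtains B where "J = ideal_of B"
  using assms by (auto simp: graded_ideal_def)

lemma graded_ideal_UNIV: "graded_ideal UNIV"
  unfolding graded_ideal_def
  by (rule exI[of _ "{1}"]) (use homogeneous_one one_in_ideal_of[of "{1}"] ideal_of_base[of 1 "{1}"] in auto)

subsection \<open>Matrices between free modules\<close>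

lemma mat_map_add: "mat_map r s A (u + v) = mat_map r s A u + mat_map r s A v"
  by (rule ext) (simp add: mat_map_def algebra_simps sum.distrib)

lemma mat_map_diff: "mat_map r s A (u - v) = mat_map r s A u - mat_map r s A v"
  by (rule ext) (simp add: mat_map_def algebra_simps sum_subtractf)

lemma mat_map_scale: "mat_map r s A (\<lambda>b. c * v b) = (\<lambda>b. c * mat_map r s A v b)"
  by (rule ext) (simp add: mat_map_def algebra_simps sum_distrib_left)

lemma mat_map_zero: "mat_map r s A 0 = 0"
  by (rule ext) (simp add: mat_map_def)

lemma mat_map_free_mod: "mat_map r s A v \<in> free_mod s"
  by (simp add: mat_map_def free_mod_def)

lemma free_mod_add: "u \<in> free_mod r \<Longrightarrow> v \<in> free_mod r \<Longrightarrow> u + v \<in> free_mod r"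
  by (simp add: free_mod_def)

lemma free_mod_diff: "u \<in> free_mod r \<Longrightarrow> v \<in> free_mod r \<Longrightarrow> u - v \<in> free_mod r"
  by (simp add: free_mod_def)

lemma free_mod_scale: "u \<in> free_mod r \<Longrightarrow> (\<lambda>b. c * u b) \<in> free_mod r"
  by (simp add: free_mod_def)

definition unit_vec :: "nat \<Rightarrow> nat \<Rightarrow> 'a::comm_ring_1" where
  "unit_vec b = (\<lambda>a. if a = b then 1 else 0)"

lemma unit_vec_free_mod: "b < r \<Longrightarrow> unit_vec b \<in> free_mod r"
  by (auto simp: unit_vec_def free_mod_def)

lemma mat_map_unit_vec: "b < r \<Longrightarrow> mat_map r s A (unit_vec b) = (\<lambda>a. if a < s then A a b else 0)"
  by (rule ext) (simp add: mat_map_def unit_vec_def if_distrib cong: if_cong)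

text \<open>Linearity is required on all functions rather than on a free module, so that
  compositions and differences need no side conditions.\<close>

definition lin :: "((nat \<Rightarrow> 'a::comm_ring_1) \<Rightarrow> nat \<Rightarrow> 'a) \<Rightarrow> bool" where
  "lin L \<longleftrightarrow> (\<forall>u v. L (u + v) = L u + L v) \<and> (\<forall>c v. L (\<lambda>b. c * v b) = (\<lambda>b. c * L v b))"

lemma lin_mat_map: "lin (mat_map r s A)"
  by (simp add: lin_def mat_map_add mat_map_scale)

lemma lin_comp: "lin L \<Longrightarrow> lin L' \<Longrightarrow> lin (\<lambda>v. L (L' v))"
  by (simp add: lin_def)

lemma lin_diff: "lin L \<Longrightarrow> lin L' \<Longrightarrow> lin (\<lambda>v. L v - L' v)"
  by (auto simp: lin_def algebra_simps fun_eq_iff)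

lemma lin_ident: "lin (\<lambda>v. v)"
  by (simp add: lin_def)

lemma free_mod_decomp:
  assumes "v \<in> free_mod r"
  shows "v = (\<Sum>b<r. (\<lambda>a. v b * unit_vec b a))"
proof (rule ext)
  fix a
  have "(\<Sum>b<r. (\<lambda>a. v b * unit_vec b a)) a = (\<Sum>b<r. v b * unit_vec b a)"
    by (induction r) auto
  also have "\<dots> = (\<Sum>b<r. if a = b then v a else 0)"
    by (rule sum.cong) (auto simp: unit_vec_def)
  also have "\<dots> = v a"
    using assms by (auto simp: free_mod_def)
  finally show "v a = (\<Sum>b<r. (\<lambda>a. v b * unit_vec b a)) a" ..
qed

lemma lin_zero: "lin L \<Longrightarrow> L 0 = 0"
  unfolding lin_def by (metis add_cancel_right_right)

lemma lin_sum: "lin L \<Longrightarrow> L (\<Sum>b<(r::nat). f b) = (\<Sum>b<r. L (f b))"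
proof (induction r)
  case 0
  then show ?case using lin_zero[of L] by (simp only: lessThan_0 sum.empty)
next
  case (Suc r)
  have "L (sum f {..<r} + f r) = L (sum f {..<r}) + L (f r)"
    using Suc.prems unfolding lin_def by blast
  with Suc show ?case by (simp only: sum.lessThan_Suc)
qed

lemma lin_eqI:
  assumes "lin L" "lin L'" "\<And>b. b < r \<Longrightarrow> L (unit_vec b) = L' (unit_vec b)" "v \<in> free_mod r"
  shows "L v = L' v"
proof -
  have "L v = (\<Sum>b<r. L (\<lambda>a. v b * unit_vec b a))"
    by (subst free_mod_decomp[OF assms(4)]) (simp add: lin_sum assms(1))
  also have "\<dots> = (\<Sum>b<r. L' (\<lambda>a. v b * unit_vec b a))"
    using assms(1-3) by (intro sum.cong) (simp_all add: lin_def)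
  also have "\<dots> = L' v"
    by (subst (2) free_mod_decomp[OF assms(4)]) (simp add: lin_sum assms(2))
  finally show ?thesis .
qed

text \<open>\<open>hvec r \<delta> d\<close> is the degree \<open>d\<close> part of the sum of the \<open>S(-\<delta> b)\<close> over \<open>b < r\<close>,
  and \<open>hmat\<close> describes the degree-preserving maps between two such modules.\<close>

definition hvec :: "nat \<Rightarrow> (nat \<Rightarrow> int) \<Rightarrow> int \<Rightarrow> (nat \<Rightarrow> ('n::finite, 'k::field) mpoly) set" where
  "hvec r \<delta> d = {v \<in> free_mod r. \<forall>b<r. homogeneous (d - \<delta> b) (v b)}"

definition hmat :: "nat \<Rightarrow> nat \<Rightarrow> (nat \<Rightarrow> int) \<Rightarrow> (nat \<Rightarrow> int) \<Rightarrow>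
    (nat \<Rightarrow> nat \<Rightarrow> ('n::finite, 'k::field) mpoly) \<Rightarrow> bool" where
  "hmat r s \<delta> \<epsilon> A \<longleftrightarrow> (\<forall>a<s. \<forall>b<r. homogeneous (\<delta> b - \<epsilon> a) (A a b))"

lemma hvec_free_mod: "v \<in> hvec r \<delta> d \<Longrightarrow> v \<in> free_mod r"
  by (simp add: hvec_def)

lemma hvec_diff: "u \<in> hvec r \<delta> d \<Longrightarrow> v \<in> hvec r \<delta> d \<Longrightarrow> u - v \<in> hvec r \<delta> d"
  by (auto simp: hvec_def free_mod_diff homogeneous_diff)

lemma mat_map_hvec:
  assumes "hmat r s \<delta> \<epsilon> A" "v \<in> hvec r \<delta> d"
  shows "mat_map r s A v \<in> hvec s \<epsilon> d"
proof -
  have "homogeneous (d - \<epsilon> a) (A a b * v b)" if "a < s" "b < r" for a b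
    by (rule homogeneous_mult'[of "\<delta> b - \<epsilon> a" _ "d - \<delta> b"]) (use assms that in \<open>auto simp: hmat_def hvec_def\<close>)
  then show ?thesis
    unfolding hvec_def using mat_map_free_mod[of r s A v]
    by (auto simp: mat_map_def intro!: homogeneous_sum)
qed

lemma unit_vec_hvec: "b < r \<Longrightarrow> unit_vec b \<in> hvec r \<delta> (\<delta> b)"
  by (auto simp: hvec_def unit_vec_free_mod) (simp add: unit_vec_def homogeneous_one homogeneous_zero)

text \<open>The universal property of a graded free module: a homogeneous image satisfying
  \<open>P b\<close> is chosen for every basis element, and the images become the columns. Chain
  maps and homotopies are built from it.\<close>

lemma hmat_columns:
  assumes "\<And>b. b < r \<Longrightarrow> \<exists>u\<in>hvec s \<epsilon> (\<delta> b). P b u"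
  obtains A where "hmat r s \<delta> \<epsilon> A" "\<And>b. b < r \<Longrightarrow> P b (mat_map r s A (unit_vec b))"
proof -
  obtain U where U: "\<And>b. b < r \<Longrightarrow> U b \<in> hvec s \<epsilon> (\<delta> b) \<and> P b (U b)"
    using assms by metis
  show thesis
  proof (rule that[of "\<lambda>a b. U b a"])
    show "hmat r s \<delta> \<epsilon> (\<lambda>a b. U b a)"
      using U by (auto simp: hmat_def hvec_def)
    fix b assume "b < r"
    moreover from this have "mat_map r s (\<lambda>a b. U b a) (unit_vec b) = U b"
      using U[of b] by (auto simp: mat_map_unit_vec hvec_def free_mod_def fun_eq_iff)
    ultimately show "P b (mat_map r s (\<lambda>a b. U b a) (unit_vec b))"
      using U by simp
  qed
qed

text \<open>Exactness supplies a preimage \<open>v\<close> of no particular degree. Since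
  \<open>A\<close> preserves degrees, the degree \<open>d\<close> part of \<open>v\<close> has the
  same image.\<close>

lemma hvec_component:
  assumes "hmat r s \<delta> \<epsilon> A" "v \<in> free_mod r" "mat_map r s A v \<in> hvec s \<epsilon> d"
  shows "\<exists>u\<in>hvec r \<delta> d. mat_map r s A u = mat_map r s A v"
proof (rule bexI)
  show "(\<lambda>b. hcomp (d - \<delta> b) (v b)) \<in> hvec r \<delta> d"
    using assms(2) by (simp add: hvec_def free_mod_def hcomp_zero homogeneous_hcomp)
  show "mat_map r s A (\<lambda>b. hcomp (d - \<delta> b) (v b)) = mat_map r s A v"
  proof (rule ext)
    fix a
    show "mat_map r s A (\<lambda>b. hcomp (d - \<delta> b) (v b)) a = mat_map r s A v a"
    proof (cases "a < s")
      case True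
      have "A a b * hcomp (d - \<delta> b) (v b) = hcomp (d - \<epsilon> a) (A a b * v b)" if "b < r" for b
      proof -
        have "homogeneous (\<delta> b - \<epsilon> a) (A a b)"
          using assms(1) True that by (simp add: hmat_def)
        from hcomp_mult[OF this, of "d - \<epsilon> a" "v b"] show ?thesis
          by simp
      qed
      then have "(\<Sum>b<r. A a b * hcomp (d - \<delta> b) (v b)) = hcomp (d - \<epsilon> a) (\<Sum>b<r. A a b * v b)"
        unfolding hcomp_sum by (intro sum.cong) auto
      moreover have "homogeneous (d - \<epsilon> a) (\<Sum>b<r. A a b * v b)"
        using assms(3) True unfolding hvec_def mat_map_def by auto
      ultimately show ?thesis
        using True by (simp add: mat_map_def hcomp_ident)
    qed (simp add: mat_map_def)
  qed
qed

subsection \<open>Resolutions\<close>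

text \<open>\<open>cyc\<close> treats the augmentation \<open>F\<^sub>0 \<rightarrow> U/V\<close> and the differentials uniformly, so that exactness
  everywhere is a single condition.\<close>

definition cyc :: "('n, 'k::field) mpoly free_cpx \<Rightarrow> ('n, 'k) mpoly set \<Rightarrow> nat \<Rightarrow>
    (nat \<Rightarrow> ('n, 'k) mpoly) \<Rightarrow> bool" where
  "cyc F V i v \<longleftrightarrow> (case i of 0 \<Rightarrow> cpx_aug F v \<in> V | Suc k \<Rightarrow> cpx_diff F k v = 0)"

lemma cyc_0: "cyc F V 0 v \<longleftrightarrow> cpx_aug F v \<in> V"
  and cyc_Suc: "cyc F V (Suc k) v \<longleftrightarrow> cpx_diff F k v = 0"
  by (simp_all add: cyc_def)

lemma cpx_aug_diff: "cpx_aug F (u - v) = cpx_aug F u - cpx_aug F v"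
  by (simp add: cpx_aug_def right_diff_distrib sum_subtractf)

lemma cpx_aug_add: "cpx_aug F (u + v) = cpx_aug F u + cpx_aug F v"
  by (simp add: cpx_aug_def distrib_left sum.distrib)

lemma cpx_aug_scale: "cpx_aug F (\<lambda>b. c * v b) = c * cpx_aug F v"
  by (simp add: cpx_aug_def mult.left_commute sum_distrib_left)

lemma cpx_diff_free_mod: "cpx_diff F i v \<in> free_mod (free_rank F i)"
  by (simp add: cpx_diff_def mat_map_free_mod)

lemma lin_cpx_diff: "lin (cpx_diff F i)"
  unfolding cpx_diff_def by (rule lin_mat_map)

abbreviation hmap :: "('n::finite, 'k::field) mpoly free_cpx \<Rightarrow> nat \<Rightarrow> ('n, 'k) mpoly free_cpx \<Rightarrow> nat \<Rightarrow>
    (nat \<Rightarrow> nat \<Rightarrow> ('n, 'k) mpoly) \<Rightarrow> bool" where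
  "hmap F i G j \<equiv> hmat (free_rank F i) (free_rank G j) (gen_deg F i) (gen_deg G j)"

abbreviation hpart :: "('n::finite, 'k::field) mpoly free_cpx \<Rightarrow> nat \<Rightarrow> int \<Rightarrow> (nat \<Rightarrow> ('n, 'k) mpoly) set" where
  "hpart F i d \<equiv> hvec (free_rank F i) (gen_deg F i) d"

abbreviation app :: "('n, 'k::field) mpoly free_cpx \<Rightarrow> nat \<Rightarrow> ('n, 'k) mpoly free_cpx \<Rightarrow> nat \<Rightarrow>
    (nat \<Rightarrow> nat \<Rightarrow> ('n, 'k) mpoly) \<Rightarrow> (nat \<Rightarrow> ('n, 'k) mpoly) \<Rightarrow> nat \<Rightarrow> ('n, 'k) mpoly" where
  "app F i G j \<equiv> mat_map (free_rank F i) (free_rank G j)"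

lemma all_nat_iff: "(\<forall>i. P i) \<longleftrightarrow> P 0 \<and> (\<forall>i. P (Suc i))"
  by (metis nat.exhaust)

lemma image_eq_iff:
  assumes "\<And>u. g u \<in> A"
  shows "{v \<in> A. P v} = g ` B \<longleftrightarrow> (\<forall>v\<in>A. P v \<longleftrightarrow> (\<exists>u\<in>B. g u = v))"
  unfolding set_eq_iff image_iff mem_Collect_eq using assms by metis

lemma graded_free_resolution_iff:
  "graded_free_resolution F U V \<longleftrightarrow>
     graded_ideal U \<and> graded_ideal V \<and> V \<subseteq> U \<and>
     (\<forall>b<free_rank F 0. aug F b \<in> U \<and> homogeneous (gen_deg F 0 b) (aug F b)) \<and>
     (\<forall>i. hmap F (Suc i) F i (dmat F i)) \<and>
     (\<forall>u\<in>U. \<exists>v\<in>free_mod (free_rank F 0). u - cpx_aug F v \<in> V) \<and>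
     (\<forall>i. \<forall>v\<in>free_mod (free_rank F i).
        cyc F V i v \<longleftrightarrow> (\<exists>u\<in>free_mod (free_rank F (Suc i)). cpx_diff F i u = v))"
  (is "_ \<longleftrightarrow> ?A \<and> ?B \<and> ?C \<and> ?D \<and> ?E \<and> ?S \<and> ?X")
proof -
  have "?X \<longleftrightarrow>
     {v \<in> free_mod (free_rank F 0). cpx_aug F v \<in> V} = cpx_diff F 0 ` free_mod (free_rank F 1) \<and>
     (\<forall>i. {v \<in> free_mod (free_rank F (Suc i)). cpx_diff F i v = (\<lambda>_. 0)} =
        cpx_diff F (Suc i) ` free_mod (free_rank F (Suc (Suc i))))" (is "_ \<longleftrightarrow> ?Y \<and> ?Z")
  proof -
    have "?X \<longleftrightarrow> (\<forall>v\<in>free_mod (free_rank F 0).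
        cyc F V 0 v \<longleftrightarrow> (\<exists>u\<in>free_mod (free_rank F (Suc 0)). cpx_diff F 0 u = v)) \<and>
       (\<forall>i. \<forall>v\<in>free_mod (free_rank F (Suc i)).
        cyc F V (Suc i) v \<longleftrightarrow> (\<exists>u\<in>free_mod (free_rank F (Suc (Suc i))). cpx_diff F (Suc i) u = v))"
      by (rule all_nat_iff)
    also have "\<dots> \<longleftrightarrow> ?Y \<and> ?Z"
      by (simp add: image_eq_iff[OF cpx_diff_free_mod] cyc_0 cyc_Suc zero_fun_def)
    finally show ?thesis .
  qed
  then show ?thesis
    unfolding graded_free_resolution_def hmat_def by auto
qed

context
  fixes F :: "('n::finite, 'k::field) mpoly free_cpx" and U V
  assumes res: "graded_free_resolution F U V"
begin

lemmas res_parts = res[unfolded graded_free_resolution_iff]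

lemma res_graded_V: "graded_ideal V"
  and res_aug: "\<And>b. b < free_rank F 0 \<Longrightarrow> aug F b \<in> U"
  and res_aug_hom: "\<And>b. b < free_rank F 0 \<Longrightarrow> homogeneous (gen_deg F 0 b) (aug F b)"
  and res_dmat: "hmap F (Suc i) F i (dmat F i)"
  using res_parts by simp_all

lemma res_surj: "u \<in> U \<Longrightarrow> \<exists>v\<in>free_mod (free_rank F 0). u - cpx_aug F v \<in> V"
  using res_parts by simp

lemma res_cyc_iff: "v \<in> free_mod (free_rank F i) \<Longrightarrow>
    cyc F V i v \<longleftrightarrow> (\<exists>u\<in>free_mod (free_rank F (Suc i)). cpx_diff F i u = v)"
  using res_parts by simp

lemma res_cyc: "u \<in> free_mod (free_rank F (Suc i)) \<Longrightarrow> cyc F V i (cpx_diff F i u)"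
  using res_cyc_iff[OF cpx_diff_free_mod] by blast

lemma res_lift:
  assumes "v \<in> hpart F i d" "cyc F V i v"
  shows "\<exists>u\<in>hpart F (Suc i) d. cpx_diff F i u = v"
proof -
  obtain u where "u \<in> free_mod (free_rank F (Suc i))" "cpx_diff F i u = v"
    using res_cyc_iff assms hvec_free_mod by blast
  then show ?thesis
    using hvec_component[OF res_dmat] assms(1) unfolding cpx_diff_def by blast
qed

text \<open>The counterpart of \<open>hvec_component\<close> for the augmentation. The equation
  holds only modulo \<open>V\<close>, and gradedness of \<open>V\<close> keeps the degree part of
  the error in \<open>V\<close>.\<close>

lemma res_aug_lift:
  assumes "u \<in> U" "homogeneous d u"
  shows "\<exists>v\<in>hpart F 0 d. u - cpx_aug F v \<in> V"
proof -
  obtain v where v: "v \<in> free_mod (free_rank F 0)" "u - cpx_aug F v \<in> V"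
    using res_surj assms(1) by blast
  define w where "w = (\<lambda>b. hcomp (d - gen_deg F 0 b) (v b))"
  have "aug F b * w b = hcomp d (aug F b * v b)" if "b < free_rank F 0" for b
    by (simp add: w_def hcomp_mult[OF res_aug_hom[OF that]])
  then have "cpx_aug F w = hcomp d (cpx_aug F v)"
    by (simp add: cpx_aug_def hcomp_sum)
  then have "u - cpx_aug F w = hcomp d (u - cpx_aug F v)"
    by (simp add: hcomp_diff hcomp_ident assms(2))
  then have "u - cpx_aug F w \<in> V"
    using graded_ideal_hcomp[OF res_graded_V v(2)] by simp
  moreover have "w \<in> hpart F 0 d"
    using v(1) by (auto simp: w_def hvec_def free_mod_def hcomp_zero homogeneous_hcomp)
  ultimately show ?thesis by blast
qed

end

subsection \<open>Independence of the resolution\<close>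

text \<open>A lift of the identity of \<open>U/V\<close>. Freeness of \<open>F\<close> reduces each
  stage to its basis elements, and exactness of \<open>G\<close> provides their images.\<close>

lemma comparison_map:
  assumes F: "graded_free_resolution F U V" and G: "graded_free_resolution G U V"
  obtains A where "\<And>i. hmap F i G i (A i)"
    "\<And>w. w \<in> free_mod (free_rank F 0) \<Longrightarrow> cpx_aug F w - cpx_aug G (app F 0 G 0 (A 0) w) \<in> V"
    "\<And>i w. w \<in> free_mod (free_rank F (Suc i)) \<Longrightarrow>
       cpx_diff G i (app F (Suc i) G (Suc i) (A (Suc i)) w) = app F i G i (A i) (cpx_diff F i w)"
proof -
  obtain B where V: "V = ideal_of B"
    using graded_idealE[OF res_graded_V[OF F]] .
  \<comment> \<open>\<open>P\<close> carries more than the commuting squares of \<open>Q\<close>: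
    that cycles go to cycles is the condition for lifting one stage further.\<close>
  define P where "P = (\<lambda>i A. hmap F i G i A \<and>
    (\<forall>w\<in>free_mod (free_rank F i). cyc F V i w \<longrightarrow> cyc G V i (app F i G i A w)) \<and>
    (i = 0 \<longrightarrow> (\<forall>w\<in>free_mod (free_rank F 0). cpx_aug F w - cpx_aug G (app F 0 G 0 A w) \<in> V)))"
  define Q where "Q = (\<lambda>i A A'. \<forall>w\<in>free_mod (free_rank F (Suc i)).
       cpx_diff G i (app F (Suc i) G (Suc i) A' w) = app F i G i A (cpx_diff F i w))"
  have "\<exists>A. P 0 A"
  proof -
    have "\<exists>v\<in>hpart G 0 (gen_deg F 0 b). aug F b - cpx_aug G v \<in> V" if "b < free_rank F 0" for b
      using res_aug_lift[OF G res_aug[OF F that] res_aug_hom[OF F that]] .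
    then obtain A where A: "hmap F 0 G 0 A"
      "\<And>b. b < free_rank F 0 \<Longrightarrow> aug F b - cpx_aug G (app F 0 G 0 A (unit_vec b)) \<in> V"
      using hmat_columns[where P = "\<lambda>b v. aug F b - cpx_aug G v \<in> V"] by metis
    \<comment> \<open>\<open>cpx_aug\<close> takes values in \<open>S\<close> and agreement holds
      only modulo \<open>V\<close>, so \<open>lin_eqI\<close> does not apply; the difference is
      expanded as a combination of the errors at the basis elements.\<close>
    have aug: "cpx_aug F w - cpx_aug G (app F 0 G 0 A w) \<in> V" for w
    proof -
      have "cpx_aug G (app F 0 G 0 A w) = (\<Sum>b<free_rank F 0. \<Sum>a<free_rank G 0. aug G a * (A a b * w b))"
        unfolding cpx_aug_def mat_map_def by (subst sum.swap) (simp add: sum_distrib_left)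
      also have "\<dots> = (\<Sum>b<free_rank F 0. w b * cpx_aug G (app F 0 G 0 A (unit_vec b)))"
        by (rule sum.cong) (auto simp: cpx_aug_def mat_map_unit_vec sum_distrib_left algebra_simps)
      finally have "cpx_aug F w - cpx_aug G (app F 0 G 0 A w) =
          (\<Sum>b<free_rank F 0. w b * (aug F b - cpx_aug G (app F 0 G 0 A (unit_vec b))))"
        by (simp add: cpx_aug_def right_diff_distrib sum_subtractf mult.commute)
      then show ?thesis
        using A(2) unfolding V by (auto intro!: ideal_of_sum ideal_of_mult)
    qed
    have "cyc G V 0 (app F 0 G 0 A w)" if "cyc F V 0 w" for w
      using aug[of w] that ideal_of_diff[of "cpx_aug F w" B "cpx_aug F w - cpx_aug G (app F 0 G 0 A w)"]
      by (simp add: cyc_0 V)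
    with A(1) aug show ?thesis
      unfolding P_def by blast
  qed
  moreover have "\<exists>A'. P (Suc i) A' \<and> Q i A A'" if "P i A" for i A
  proof -
    have hom: "hmap F i G i A" and cyc: "\<And>w. w \<in> free_mod (free_rank F i) \<Longrightarrow> cyc F V i w \<Longrightarrow> cyc G V i (app F i G i A w)"
      using that by (auto simp: P_def)
    have "\<exists>u\<in>hpart G (Suc i) (gen_deg F (Suc i) b).
        cpx_diff G i u = app F i G i A (cpx_diff F i (unit_vec b))" if b: "b < free_rank F (Suc i)" for b
    proof (rule res_lift[OF G])
      show "app F i G i A (cpx_diff F i (unit_vec b)) \<in> hpart G i (gen_deg F (Suc i) b)"
        unfolding cpx_diff_def by (intro mat_map_hvec[OF hom] mat_map_hvec[OF res_dmat[OF F]] unit_vec_hvec b)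
      show "cyc G V i (app F i G i A (cpx_diff F i (unit_vec b)))"
        by (intro cyc cpx_diff_free_mod res_cyc[OF F] unit_vec_free_mod b)
    qed
    then obtain A' where A': "hmap F (Suc i) G (Suc i) A'"
      "\<And>b. b < free_rank F (Suc i) \<Longrightarrow>
        cpx_diff G i (app F (Suc i) G (Suc i) A' (unit_vec b)) = app F i G i A (cpx_diff F i (unit_vec b))"
      using hmat_columns[where P = "\<lambda>b u. cpx_diff G i u = app F i G i A (cpx_diff F i (unit_vec b))"]
      by metis
    have Q: "Q i A A'"
      unfolding Q_def
      by (intro ballI) (rule lin_eqI[OF lin_comp[OF lin_cpx_diff lin_mat_map] lin_comp[OF lin_mat_map lin_cpx_diff] A'(2)])
    then have "P (Suc i) A'"
      using A'(1) by (auto simp: P_def Q_def cyc_Suc mat_map_zero)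
    with Q show ?thesis by blast
  qed
  ultimately obtain A where "\<And>i. P i (A i)" "\<And>i. Q i (A i) (A (Suc i))"
    using dependent_nat_choice[of P Q] by metis
  then show thesis
    using that[of A] unfolding P_def Q_def by blast
qed

text \<open>The obstruction to constructing the next map is always a cycle, hence a boundary. The
  endomorphism \<open>\<theta>\<close> is a family of functions, not of matrices, so that a
  composite minus the identity can be inserted directly.\<close>

lemma null_homotopy:
  assumes F: "graded_free_resolution F U V"
    and lin: "\<And>i. lin (\<theta> i)"
    and hom: "\<And>i d w. w \<in> hpart F i d \<Longrightarrow> \<theta> i w \<in> hpart F i d"
    and aug: "\<And>w. w \<in> free_mod (free_rank F 0) \<Longrightarrow> cpx_aug F (\<theta> 0 w) \<in> V"
    and comm: "\<And>i w. w \<in> free_mod (free_rank F (Suc i)) \<Longrightarrow> cpx_diff F i (\<theta> (Suc i) w) = \<theta> i (cpx_diff F i w)"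
  obtains H where "\<And>i. hmap F i F (Suc i) (H i)"
    "\<And>w. w \<in> free_mod (free_rank F 0) \<Longrightarrow> cpx_diff F 0 (app F 0 F 1 (H 0) w) = \<theta> 0 w"
    "\<And>i w. w \<in> free_mod (free_rank F (Suc i)) \<Longrightarrow>
       cpx_diff F (Suc i) (app F (Suc i) F (Suc (Suc i)) (H (Suc i)) w) +
       app F i F (Suc i) (H i) (cpx_diff F i w) = \<theta> (Suc i) w"
proof -
  \<comment> \<open>On cycles the homotopy identity loses its second term, and what remains is all
    that the next stage needs. In position 0 there is no second term and the equation holds
    everywhere.\<close>
  define P where "P = (\<lambda>i H. hmap F i F (Suc i) H \<and>
    (\<forall>w\<in>free_mod (free_rank F i). (i = 0 \<or> cyc F V i w) \<longrightarrow> cpx_diff F i (app F i F (Suc i) H w) = \<theta> i w))"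
  define Q where "Q = (\<lambda>i H H'. \<forall>w\<in>free_mod (free_rank F (Suc i)).
       cpx_diff F (Suc i) (app F (Suc i) F (Suc (Suc i)) H' w) +
       app F i F (Suc i) H (cpx_diff F i w) = \<theta> (Suc i) w)"
  have "\<exists>H. P 0 H"
  proof -
    have "\<exists>u\<in>hpart F (Suc 0) (gen_deg F 0 b). cpx_diff F 0 u = \<theta> 0 (unit_vec b)" if "b < free_rank F 0" for b
      by (rule res_lift[OF F]) (simp_all add: that hom unit_vec_hvec unit_vec_free_mod aug cyc_0)
    then obtain H where H: "hmap F 0 F (Suc 0) H"
      "\<And>b. b < free_rank F 0 \<Longrightarrow> cpx_diff F 0 (app F 0 F (Suc 0) H (unit_vec b)) = \<theta> 0 (unit_vec b)"
      using hmat_columns[where P = "\<lambda>b u. cpx_diff F 0 u = \<theta> 0 (unit_vec b)"] by metis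
    have "cpx_diff F 0 (app F 0 F (Suc 0) H w) = \<theta> 0 w" if "w \<in> free_mod (free_rank F 0)" for w
      by (rule lin_eqI[OF lin_comp[OF lin_cpx_diff lin_mat_map] lin H(2) that])
    with H(1) show ?thesis
      unfolding P_def by blast
  qed
  moreover have "\<exists>H'. P (Suc i) H' \<and> Q i H H'" if "P i H" for i H
  proof -
    have H: "hmap F i F (Suc i) H"
      "\<And>w. w \<in> free_mod (free_rank F i) \<Longrightarrow> cyc F V i w \<Longrightarrow> cpx_diff F i (app F i F (Suc i) H w) = \<theta> i w"
      using that by (auto simp: P_def)
    \<comment> \<open>The part of \<open>\<theta> (Suc i)\<close> that the next map has to produce.
      Its values on the free module are cycles: by the invariant at the cycle
      \<open>cpx_diff F i w\<close>, the differential of the subtracted term is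
      \<open>\<theta> i (cpx_diff F i w)\<close>.\<close>
    define L where "L = (\<lambda>w. \<theta> (Suc i) w - app F i F (Suc i) H (cpx_diff F i w))"
    have L: "lin L"
      unfolding L_def by (rule lin_diff[OF lin lin_comp[OF lin_mat_map lin_cpx_diff]])
    have "\<exists>u\<in>hpart F (Suc (Suc i)) (gen_deg F (Suc i) b). cpx_diff F (Suc i) u = L (unit_vec b)"
      if b: "b < free_rank F (Suc i)" for b
    proof (rule res_lift[OF F])
      show "L (unit_vec b) \<in> hpart F (Suc i) (gen_deg F (Suc i) b)"
        unfolding L_def cpx_diff_def
        by (intro hvec_diff hom mat_map_hvec[OF H(1)] mat_map_hvec[OF res_dmat[OF F]] unit_vec_hvec b)
      have "cpx_diff F i (app F i F (Suc i) H (cpx_diff F i (unit_vec b))) = \<theta> i (cpx_diff F i (unit_vec b))"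
        by (intro H(2) cpx_diff_free_mod res_cyc[OF F] unit_vec_free_mod b)
      also have "\<dots> = cpx_diff F i (\<theta> (Suc i) (unit_vec b))"
        by (intro comm[symmetric] unit_vec_free_mod b)
      finally show "cyc F V (Suc i) (L (unit_vec b))"
        by (simp add: cyc_Suc L_def cpx_diff_def mat_map_diff)
    qed
    then obtain H' where H': "hmap F (Suc i) F (Suc (Suc i)) H'"
      "\<And>b. b < free_rank F (Suc i) \<Longrightarrow>
        cpx_diff F (Suc i) (app F (Suc i) F (Suc (Suc i)) H' (unit_vec b)) = L (unit_vec b)"
      using hmat_columns[where P = "\<lambda>b u. cpx_diff F (Suc i) u = L (unit_vec b)"] by metis
    have eq: "cpx_diff F (Suc i) (app F (Suc i) F (Suc (Suc i)) H' w) = L w"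
      if "w \<in> free_mod (free_rank F (Suc i))" for w
      by (rule lin_eqI[OF lin_comp[OF lin_cpx_diff lin_mat_map] L H'(2) that])
    then have "Q i H H'"
      by (simp add: Q_def L_def)
    moreover have "P (Suc i) H'"
      using H'(1) eq by (auto simp: P_def L_def cyc_Suc mat_map_zero)
    ultimately show ?thesis by blast
  qed
  ultimately obtain H where "\<And>i. P i (H i)" "\<And>i. Q i (H i) (H (Suc i))"
    using dependent_nat_choice[of P Q] by metis
  then show thesis
    using that[of H] unfolding P_def Q_def One_nat_def by blast
qed

section \<open>Dimensions of subquotients of vector spaces over K\<close>

interpretation kvec: vector_space "\<lambda>(c::'k::field) (v::nat \<Rightarrow> 'k) b. c * v b"
  by unfold_locales (simp_all add: algebra_simps fun_eq_iff)

declare kvec.scale_scale [simp del]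

lemma lin_module_hom: "lin (L :: (nat \<Rightarrow> 'k::field) \<Rightarrow> _) \<Longrightarrow> module_hom (\<lambda>c v b. c * v b) (\<lambda>c v b. c * v b) L"
  unfolding module_hom_iff using kvec.module_axioms by (simp add: lin_def)

lemma free_mod_span: "free_mod r \<subseteq> kvec.span (unit_vec ` {..<r})"
proof
  fix v :: "nat \<Rightarrow> 'k::field" assume "v \<in> free_mod r"
  then have "v = (\<Sum>b<r. (\<lambda>a. v b * unit_vec b a))"
    by (rule free_mod_decomp)
  also have "\<dots> \<in> kvec.span (unit_vec ` {..<r})"
    by (intro kvec.span_sum kvec.span_scale kvec.span_base) auto
  finally show "v \<in> kvec.span (unit_vec ` {..<r})" .
qed

text \<open>The space of all functions is infinite-dimensional; finiteness of the bases below comes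
  from the unit vectors spanning \<open>free_mod r\<close>.\<close>

lemma independent_free_mod_finite:
  assumes "kvec.independent S" "S \<subseteq> free_mod r"
  shows "finite S"
  using kvec.independent_span_bound[of "unit_vec ` {..<r}" S] assms free_mod_span[of r] by auto

text \<open>By \<open>ker\<close>, independence modulo \<open>B\<close> becomes independence modulo
  \<open>B'\<close>. So a basis \<open>S\<close> of \<open>B\<close> is extended to a basis
  \<open>T\<close> of \<open>Z\<close>, and the images of \<open>T - S\<close> together with a basis
  of \<open>B'\<close> form an independent set in \<open>Z'\<close>.\<close>

lemma dim_quotient_le:
  fixes f :: "(nat \<Rightarrow> 'k::field) \<Rightarrow> nat \<Rightarrow> 'k"
  assumes f: "lin f"
    and B: "kvec.subspace B" "B \<subseteq> Z" "Z \<subseteq> free_mod r"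
    and B': "kvec.subspace B'" "B' \<subseteq> Z'" "Z' \<subseteq> free_mod r'"
    and fZ: "\<And>z. z \<in> Z \<Longrightarrow> f z \<in> Z'" and ker: "\<And>z. z \<in> Z \<Longrightarrow> f z \<in> B' \<Longrightarrow> z \<in> B"
    and Z: "kvec.subspace Z"
  shows "vec_dim Z - vec_dim B \<le> vec_dim Z' - vec_dim B'"
proof -
  obtain S where S: "S \<subseteq> B" "kvec.independent S" "B \<subseteq> kvec.span S" "card S = kvec.dim B"
    using kvec.basis_exists by blast
  obtain T where T: "S \<subseteq> T" "T \<subseteq> Z" "kvec.independent T" "Z \<subseteq> kvec.span T"
    using kvec.maximal_independent_subset_extend[of S Z] S B(2) by blast
  obtain S' where S': "S' \<subseteq> B'" "kvec.independent S'" "B' \<subseteq> kvec.span S'" "card S' = kvec.dim B'"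
    using kvec.basis_exists by blast
  have fin: "finite T" "finite S'"
    using independent_free_mod_finite[OF T(3)] independent_free_mod_finite[OF S'(2)] T(2) S'(1) B(3) B'(2,3)
    by (metis subset_trans)+
  interpret h: module_hom "\<lambda>c v b. c * v b" "\<lambda>c v b. c * v b" f
    by (rule lin_module_hom[OF f])
  \<comment> \<open>The cardinality belongs to the induction, as \<open>f\<close> must neither
    identify elements of \<open>T - S\<close> nor send them into \<open>S'\<close>.\<close>
  have "kvec.independent (S' \<union> f ` D) \<and> card (S' \<union> f ` D) = card S' + card D" if "finite D" "D \<subseteq> T - S" for D
    using that
  proof (induction D)
    case empty
    then show ?case using S'(2) by simp
  next
    case (insert c D)
    \<comment> \<open>A relation \<open>f c = x + f d\<close> with \<open>x\<close> in
      \<open>B'\<close> puts \<open>c - d\<close> into \<open>B\<close>, hence \<open>c\<close> into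
      the span of \<open>S \<union> D\<close>, against the independence of \<open>T\<close>.\<close>
    have "f c \<notin> kvec.span (S' \<union> f ` D)"
    proof
      assume "f c \<in> kvec.span (S' \<union> f ` D)"
      then obtain x d where xd: "x \<in> kvec.span S'" "d \<in> kvec.span D" "f c = x + f d"
        unfolding kvec.span_Un h.span_image by auto
      have "x \<in> B'"
        using xd(1) kvec.span_minimal[OF S'(1) B'(1)] by auto
      moreover have "f (c - d) = x"
        using xd(3) h.diff by simp
      moreover have "D \<subseteq> Z"
        using insert.prems T(2) by auto
      then have "d \<in> Z"
        using kvec.span_minimal[OF _ Z] xd(2) by auto
      then have "c - d \<in> Z"
        using insert.prems T(2) kvec.subspace_diff[OF Z] by auto
      ultimately have "c - d \<in> kvec.span S"
        using ker S(3) by auto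
      then have "(c - d) + d \<in> kvec.span (S \<union> D)"
        using xd(2) kvec.span_mono[of S "S \<union> D"] kvec.span_mono[of D "S \<union> D"]
        by (intro kvec.span_add) auto
      then have "c \<in> kvec.span (S \<union> D)"
        by (simp only: diff_add_cancel)
      moreover have "S \<union> D \<subseteq> T - {c}"
        using insert T(1) by auto
      ultimately have "c \<in> kvec.span (T - {c})"
        using kvec.span_mono by blast
      then show False
        using T(3) insert.prems unfolding kvec.dependent_def by auto
    qed
    moreover from this have "f c \<notin> S' \<union> f ` D"
      using kvec.span_base[of "f c" "S' \<union> f ` D"] by argo
    ultimately show ?case
      using insert fin by (simp add: kvec.independent_insert)
  qed
  from this[of "T - S"] fin have C: "kvec.independent (S' \<union> f ` (T - S))"
    "card (S' \<union> f ` (T - S)) = card S' + card (T - S)" by auto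
  have "S' \<union> f ` (T - S) \<subseteq> Z'"
    using S'(1) B'(2) T(2) fZ by auto
  moreover obtain W where W: "W \<subseteq> Z'" "kvec.independent W" "Z' \<subseteq> kvec.span W" "card W = kvec.dim Z'"
    using kvec.basis_exists by blast
  moreover have "finite W"
    using independent_free_mod_finite[OF W(2)] W(1) B'(3) by (meson subset_trans)
  ultimately have "card S' + card (T - S) \<le> kvec.dim Z'"
    using kvec.independent_span_bound[of W "S' \<union> f ` (T - S)"] C by (metis subset_trans)
  moreover have "kvec.dim Z = card T"
    using kvec.basis_card_eq_dim[OF T(2,4,3)] ..
  moreover have "card (T - S) = card T - card S"
    using card_Diff_subset[of S T] T(1) fin finite_subset by blast
  ultimately show ?thesis
    unfolding vec_dim_def using S(4) S'(4) by simp
qed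

subsection \<open>Reduction modulo the irrelevant ideal\<close>

definition eps :: "(nat \<Rightarrow> ('n, 'k::field) mpoly) \<Rightarrow> nat \<Rightarrow> 'k" where
  "eps w = (\<lambda>b. Poly_Mapping.lookup (w b) 0)"

text \<open>A section of \<open>eps\<close>: an identity over \<open>S\<close> is carried to
  \<open>K\<close> by evaluating it at \<open>const_vec v\<close> and applying
  \<open>eps\<close>.\<close>

definition const_vec :: "(nat \<Rightarrow> 'k::field) \<Rightarrow> nat \<Rightarrow> ('n, 'k) mpoly" where
  "const_vec v = (\<lambda>b. Poly_Mapping.single 0 (v b))"

abbreviation bar :: "(nat \<Rightarrow> nat \<Rightarrow> ('n, 'k::field) mpoly) \<Rightarrow> nat \<Rightarrow> nat \<Rightarrow> 'k" where
  "bar A \<equiv> \<lambda>a b. Poly_Mapping.lookup (A a b) 0"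

lemma eps_const_vec: "eps (const_vec v) = v"
  by (simp add: eps_def const_vec_def)

lemma const_vec_free_mod: "v \<in> free_mod r \<Longrightarrow> const_vec v \<in> free_mod r"
  by (simp add: const_vec_def free_mod_def)

lemma eps_mat_map: "eps (mat_map r s A (w :: nat \<Rightarrow> ('n::finite, 'k::field) mpoly)) = mat_map r s (bar A) (eps w)"
  by (rule ext) (simp add: eps_def mat_map_def lookup_sum lookup_mult_zero)

lemma eps_cpx_diff: "eps (cpx_diff (F :: ('n::finite, 'k::field) mpoly free_cpx) i w) = tensor_diff F i (eps w)"
  unfolding cpx_diff_def tensor_diff_def by (rule eps_mat_map)

lemma eps_zero: "eps 0 = 0"
  by (rule ext) (simp add: eps_def)

lemma eps_add: "eps (u + v) = eps u + eps v"
  by (rule ext) (simp add: eps_def lookup_add)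

lemma eps_diff: "eps (u - v) = eps u - eps v"
  by (rule ext) (simp add: eps_def lookup_minus)

text \<open>A nonzero constant coefficient occurs only in an entry of degree 0, that is, between
  generators of equal degree.\<close>

lemma tensor_mod_bar:
  assumes "hmap F i G k A" "v \<in> tensor_mod F i j"
  shows "mat_map (free_rank F i) (free_rank G k) (bar A) v \<in> tensor_mod G k j"
  unfolding tensor_mod_def
proof (intro CollectI conjI mat_map_free_mod allI impI)
  fix a assume nz: "mat_map (free_rank F i) (free_rank G k) (bar A) v a \<noteq> 0"
  then have a: "a < free_rank G k"
    by (auto simp: mat_map_def split: if_splits)
  with nz have "(\<Sum>b<free_rank F i. bar A a b * v b) \<noteq> 0"
    by (simp add: mat_map_def)
  then obtain b where b: "b < free_rank F i" "bar A a b * v b \<noteq> 0"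
    by (metis (no_types, lifting) lessThan_iff sum.neutral)
  then have "gen_deg F i b - gen_deg G k a = 0"
    using assms(1) a homogeneous_lookup_zero unfolding hmat_def by fastforce
  with b assms(2) show "gen_deg G k a = j"
    by (auto simp: tensor_mod_def)
qed

lemma tensor_mod_subspace: "kvec.subspace (tensor_mod F i j)"
proof (rule kvec.subspaceI)
  fix x y assume "x \<in> tensor_mod F i j" "y \<in> tensor_mod F i j"
  moreover have "x b \<noteq> 0 \<or> y b \<noteq> 0" if "(x + y) b \<noteq> 0" for b
    using that by auto
  ultimately show "x + y \<in> tensor_mod F i j"
    unfolding tensor_mod_def using free_mod_add by blast
qed (auto simp: tensor_mod_def free_mod_def)

lemma lin_tensor_diff: "lin (tensor_diff F i)"
  unfolding tensor_diff_def by (rule lin_mat_map)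

lemma tensor_boundaries_subspace: "kvec.subspace (tensor_boundaries F i j)"
  unfolding tensor_boundaries_def
  by (rule module_hom.subspace_image[OF lin_module_hom[OF lin_tensor_diff] tensor_mod_subspace])

lemma tensor_cycles_eq:
  "tensor_cycles F 0 j = tensor_mod F 0 j"
  "tensor_cycles F (Suc k) j = {v \<in> tensor_mod F (Suc k) j. tensor_diff F k v = 0}"
  by (simp_all add: tensor_cycles_def zero_fun_def)

lemma tensor_cycles_subspace: "kvec.subspace (tensor_cycles F i j)"
proof (cases i)
  case (Suc k)
  have "kvec.subspace {v. tensor_diff F k v = 0}"
    by (rule module_hom.subspace_kernel[OF lin_module_hom[OF lin_tensor_diff]])
  then show ?thesis
    unfolding Suc tensor_cycles_eq Collect_conj_eq Collect_mem_eq
    by (rule kvec.subspace_inter[OF tensor_mod_subspace])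
qed (simp add: tensor_cycles_eq tensor_mod_subspace)

lemma tensor_cycles_subset: "tensor_cycles F i j \<subseteq> tensor_mod F i j"
  by (cases i) (auto simp: tensor_cycles_eq)

lemma tensor_mod_subset: "tensor_mod F i j \<subseteq> free_mod (free_rank F i)"
  by (auto simp: tensor_mod_def)

lemma const_vec_tensor_mod: "v \<in> tensor_mod F i j \<Longrightarrow> const_vec v \<in> free_mod (free_rank F i)"
  using tensor_mod_subset by (rule const_vec_free_mod[OF subsetD])

lemma tensor_boundaries_subset:
  assumes F: "graded_free_resolution F U V"
  shows "tensor_boundaries F i j \<subseteq> tensor_cycles F i j"
proof
  fix v assume "v \<in> tensor_boundaries F i j"
  then obtain u where u: "u \<in> tensor_mod F (Suc i) j" "v = tensor_diff F i u"
    by (auto simp: tensor_boundaries_def)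
  have v: "v \<in> tensor_mod F i j"
    unfolding u(2) tensor_diff_def by (rule tensor_mod_bar[OF res_dmat[OF F] u(1)])
  show "v \<in> tensor_cycles F i j"
  proof (cases i)
    case (Suc k)
    have "cyc F V i (cpx_diff F i (const_vec u))"
      by (rule res_cyc[OF F const_vec_tensor_mod[OF u(1)]])
    then have "eps (cpx_diff F k (cpx_diff F i (const_vec u))) = 0"
      by (simp add: Suc cyc_Suc eps_zero)
    then have "tensor_diff F k v = 0"
      unfolding eps_cpx_diff eps_const_vec u(2) .
    then show ?thesis
      using v by (simp add: Suc tensor_cycles_eq)
  qed (use v in \<open>simp add: tensor_cycles_eq\<close>)
qed

text \<open>Since \<open>\<psi>\<close> after \<open>\<phi>\<close> is homotopic to the identity of
  \<open>F\<close>, the reduction of \<open>\<phi>\<close> is injective on homology, and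
  \<open>dim_quotient_le\<close> applies.\<close>

lemma homology_dim_le:
  assumes F: "graded_free_resolution F U V" and G: "graded_free_resolution G U V"
  shows "homology_dim F i j \<le> homology_dim G i j"
proof -
  obtain B where V: "V = ideal_of B"
    using graded_idealE[OF res_graded_V[OF F]] .
  obtain \<phi> where \<phi>: "\<And>i. hmap F i G i (\<phi> i)"
    "\<And>w. w \<in> free_mod (free_rank F 0) \<Longrightarrow> cpx_aug F w - cpx_aug G (app F 0 G 0 (\<phi> 0) w) \<in> V"
    "\<And>i w. w \<in> free_mod (free_rank F (Suc i)) \<Longrightarrow>
       cpx_diff G i (app F (Suc i) G (Suc i) (\<phi> (Suc i)) w) = app F i G i (\<phi> i) (cpx_diff F i w)"
    using comparison_map[OF F G] by blast
  obtain \<psi> where \<psi>: "\<And>i. hmap G i F i (\<psi> i)"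
    "\<And>w. w \<in> free_mod (free_rank G 0) \<Longrightarrow> cpx_aug G w - cpx_aug F (app G 0 F 0 (\<psi> 0) w) \<in> V"
    "\<And>i w. w \<in> free_mod (free_rank G (Suc i)) \<Longrightarrow>
       cpx_diff F i (app G (Suc i) F (Suc i) (\<psi> (Suc i)) w) = app G i F i (\<psi> i) (cpx_diff G i w)"
    using comparison_map[OF G F] by blast
  define \<theta> where "\<theta> = (\<lambda>i w. app G i F i (\<psi> i) (app F i G i (\<phi> i) w) - w)"
  obtain H where H: "\<And>i. hmap F i F (Suc i) (H i)"
    "\<And>w. w \<in> free_mod (free_rank F 0) \<Longrightarrow> cpx_diff F 0 (app F 0 F 1 (H 0) w) = \<theta> 0 w"
    "\<And>i w. w \<in> free_mod (free_rank F (Suc i)) \<Longrightarrow>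
       cpx_diff F (Suc i) (app F (Suc i) F (Suc (Suc i)) (H (Suc i)) w) +
       app F i F (Suc i) (H i) (cpx_diff F i w) = \<theta> (Suc i) w"
  proof (rule null_homotopy[OF F, of \<theta>])
    show "lin (\<theta> i)" for i
      unfolding \<theta>_def by (rule lin_diff[OF lin_comp[OF lin_mat_map lin_mat_map] lin_ident])
    show "\<theta> i w \<in> hpart F i d" if "w \<in> hpart F i d" for i d w
      unfolding \<theta>_def by (intro hvec_diff mat_map_hvec[OF \<psi>(1)] mat_map_hvec[OF \<phi>(1)] that)
    show "cpx_aug F (\<theta> 0 w) \<in> V" if "w \<in> free_mod (free_rank F 0)" for w
    proof -
      define x where "x = app F 0 G 0 (\<phi> 0) w"
      have "cpx_aug F w - cpx_aug G x \<in> V" "cpx_aug G x - cpx_aug F (app G 0 F 0 (\<psi> 0) x) \<in> V"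
        unfolding x_def by (intro \<phi>(2) \<psi>(2) that mat_map_free_mod)+
      \<comment> \<open>The two errors add up to \<open>- cpx_aug F (\<theta> 0 w)\<close>.\<close>
      then have "0 - (cpx_aug F w - cpx_aug G x + (cpx_aug G x - cpx_aug F (app G 0 F 0 (\<psi> 0) x))) \<in> V"
        unfolding V by (rule ideal_of_diff[OF ideal_of_zero ideal_of_add])
      then show ?thesis
        by (simp add: \<theta>_def cpx_aug_diff x_def)
    qed
    show "cpx_diff F i (\<theta> (Suc i) w) = \<theta> i (cpx_diff F i w)" if "w \<in> free_mod (free_rank F (Suc i))" for i w
    proof -
      have "cpx_diff F i (\<theta> (Suc i) w) =
          cpx_diff F i (app G (Suc i) F (Suc i) (\<psi> (Suc i)) (app F (Suc i) G (Suc i) (\<phi> (Suc i)) w)) - cpx_diff F i w"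
        by (simp only: \<theta>_def cpx_diff_def mat_map_diff)
      then show ?thesis
        by (simp only: \<psi>(3)[OF mat_map_free_mod] \<phi>(3)[OF that] \<theta>_def)
    qed
  qed blast
  let ?f = "mat_map (free_rank F i) (free_rank G i) (bar (\<phi> i))"
  let ?g = "\<lambda>i. mat_map (free_rank G i) (free_rank F i) (bar (\<psi> i))"
  let ?h = "mat_map (free_rank F i) (free_rank F (Suc i)) (bar (H i))"
  have fZ: "?f z \<in> tensor_cycles G i j" if z: "z \<in> tensor_cycles F i j" for z
  proof -
    have z': "z \<in> tensor_mod F i j"
      using z tensor_cycles_subset by auto
    have fz: "?f z \<in> tensor_mod G i j"
      by (rule tensor_mod_bar[OF \<phi>(1) z'])
    show ?thesis
    proof (cases i)
      case (Suc k)
      have "eps (cpx_diff G k (app F (Suc k) G (Suc k) (\<phi> (Suc k)) (const_vec z))) =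
          eps (app F k G k (\<phi> k) (cpx_diff F k (const_vec z)))"
        using \<phi>(3)[OF const_vec_tensor_mod[OF z'[unfolded Suc]]] by simp
      then have "tensor_diff G k (?f z) = mat_map (free_rank F k) (free_rank G k) (bar (\<phi> k)) (tensor_diff F k z)"
        unfolding eps_cpx_diff eps_mat_map eps_const_vec Suc .
      also have "tensor_diff F k z = 0"
        using z by (simp add: Suc tensor_cycles_eq)
      finally have "tensor_diff G k (?f z) = 0"
        unfolding mat_map_zero .
      then show ?thesis
        using fz by (simp add: Suc tensor_cycles_eq)
    qed (use fz in \<open>simp add: tensor_cycles_eq\<close>)
  qed
  \<comment> \<open>Injectivity on homology: from \<open>\<phi> z = d y\<close> and the homotopy at
    the cycle \<open>z\<close> one gets \<open>z = d (\<psi> y - h z)\<close>.\<close>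
  have ker: "z \<in> tensor_boundaries F i j" if z: "z \<in> tensor_cycles F i j" and fz: "?f z \<in> tensor_boundaries G i j" for z
  proof -
    have z': "z \<in> tensor_mod F i j"
      using z tensor_cycles_subset by auto
    obtain y where y: "y \<in> tensor_mod G (Suc i) j" "?f z = tensor_diff G i y"
      using fz by (auto simp: tensor_boundaries_def)
    have gfz: "?g i (?f z) = tensor_diff F i (?g (Suc i) y)"
    proof -
      have "eps (cpx_diff F i (app G (Suc i) F (Suc i) (\<psi> (Suc i)) (const_vec y))) =
          eps (app G i F i (\<psi> i) (cpx_diff G i (const_vec y)))"
        using \<psi>(3)[OF const_vec_tensor_mod[OF y(1)]] by simp
      then show ?thesis
        unfolding eps_cpx_diff eps_mat_map eps_const_vec y(2) by simp
    qed
    have "eps (\<theta> i (const_vec z)) = ?g i (?f z) - z"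
      unfolding \<theta>_def eps_diff eps_mat_map eps_const_vec ..
    moreover have "eps (\<theta> i (const_vec z)) = tensor_diff F i (?h z)"
    proof (cases i)
      case 0
      have "eps (\<theta> 0 (const_vec z)) = eps (cpx_diff F 0 (app F 0 F 1 (H 0) (const_vec z)))"
        using H(2)[OF const_vec_tensor_mod[OF z'[unfolded 0]]] by simp
      then show ?thesis
        unfolding 0 eps_cpx_diff eps_mat_map eps_const_vec by simp
    next
      case (Suc k)
      have "tensor_diff F k z = 0"
        using z by (simp add: Suc tensor_cycles_eq)
      moreover have "eps (\<theta> (Suc k) (const_vec z)) = tensor_diff F (Suc k)
          (mat_map (free_rank F (Suc k)) (free_rank F (Suc (Suc k))) (bar (H (Suc k))) z) +
          mat_map (free_rank F k) (free_rank F (Suc k)) (bar (H k)) (tensor_diff F k z)"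
        unfolding H(3)[OF const_vec_tensor_mod[OF z'[unfolded Suc]], symmetric]
        unfolding eps_add eps_cpx_diff eps_mat_map eps_const_vec ..
      ultimately show ?thesis
        by (simp add: Suc mat_map_zero)
    qed
    ultimately have "z = tensor_diff F i (?g (Suc i) y) - tensor_diff F i (?h z)"
      unfolding gfz by (metis add_diff_cancel_left' diff_add_cancel)
    then have "z = tensor_diff F i (?g (Suc i) y - ?h z)"
      by (simp add: tensor_diff_def mat_map_diff)
    moreover have "?g (Suc i) y - ?h z \<in> tensor_mod F (Suc i) j"
      by (intro kvec.subspace_diff[OF tensor_mod_subspace] tensor_mod_bar[OF \<psi>(1) y(1)] tensor_mod_bar[OF H(1) z'])
    ultimately show ?thesis
      unfolding tensor_boundaries_def by blast
  qed
  show ?thesis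
    unfolding homology_dim_def
    by (rule dim_quotient_le[OF lin_mat_map tensor_boundaries_subspace tensor_boundaries_subset[OF F] _
          tensor_boundaries_subspace tensor_boundaries_subset[OF G] _ fZ ker tensor_cycles_subspace])
      (use tensor_cycles_subset tensor_mod_subset in blast)+
qed

lemma betti_eq_homology_dim:
  assumes "graded_free_resolution F U V"
  shows "betti i j U V = homology_dim F i j"
proof -
  have "graded_free_resolution (SOME F. graded_free_resolution F U V) U V"
    using assms by (rule someI)
  then show ?thesis
    unfolding betti_def using homology_dim_le assms by (meson order_antisym)
qed

subsection \<open>Minimal resolutions\<close>

definition minimal :: "('n, 'k::field) mpoly free_cpx \<Rightarrow> bool" where
  "minimal F \<longleftrightarrow> (\<forall>i. \<forall>a<free_rank F i. \<forall>b<free_rank F (Suc i). Poly_Mapping.lookup (dmat F i a b) 0 = 0)"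

definition num_gens :: "('n, 'k::field) mpoly free_cpx \<Rightarrow> nat \<Rightarrow> int \<Rightarrow> nat" where
  "num_gens F i j = card {b. b < free_rank F i \<and> gen_deg F i b = j}"

lemma sum_fun_apply: "(\<Sum>t\<in>T. f t) x = (\<Sum>t\<in>T. f t x)"
  by (induction T rule: infinite_finite_induct) auto

lemma vec_dim_tensor_mod:
  fixes F :: "('n, 'k::field) mpoly free_cpx"
  shows "vec_dim (tensor_mod F i j) = num_gens F i j"
proof -
  let ?T = "{b. b < free_rank F i \<and> gen_deg F i b = j}"
  let ?B = "unit_vec ` ?T :: (nat \<Rightarrow> 'k) set"
  have inj: "inj_on (unit_vec :: nat \<Rightarrow> nat \<Rightarrow> 'k) ?T"
    by (rule inj_onI) (metis unit_vec_def zero_neq_one)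
  have sub: "?B \<subseteq> tensor_mod F i j"
    by (auto simp: tensor_mod_def unit_vec_free_mod) (auto simp: unit_vec_def split: if_splits)
  have span: "tensor_mod F i j \<subseteq> kvec.span ?B"
  proof
    fix v assume v: "v \<in> tensor_mod F i j"
    then have "v = (\<Sum>b<free_rank F i. (\<lambda>a. v b * unit_vec b a))"
      by (intro free_mod_decomp) (auto simp: tensor_mod_def)
    also have "\<dots> \<in> kvec.span ?B"
    proof (rule kvec.span_sum)
      fix b assume b: "b \<in> {..<free_rank F i}"
      show "(\<lambda>a. v b * unit_vec b a) \<in> kvec.span ?B"
      proof (cases "v b = 0")
        case True
        then show ?thesis
          using kvec.span_zero[of ?B] by (simp add: zero_fun_def)
      next
        case False
        then have "b \<in> ?T"
          using v b by (auto simp: tensor_mod_def)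
        then show ?thesis
          by (intro kvec.span_scale kvec.span_base) auto
      qed
    qed
    finally show "v \<in> kvec.span ?B" .
  qed
  have "kvec.independent ?B"
  proof (rule kvec.independent_if_scalars_zero)
    show "finite ?B" by simp
    fix c x assume c: "(\<Sum>x\<in>?B. (\<lambda>b. c x * x b)) = 0" and x: "x \<in> ?B"
    obtain b where b: "b \<in> ?T" "x = unit_vec b"
      using x by auto
    have "(\<Sum>x\<in>?B. (\<lambda>b. c x * x b)) = (\<Sum>t\<in>?T. (\<lambda>a. c (unit_vec t) * unit_vec t a))"
      by (simp add: sum.reindex[OF inj])
    then have "0 = (\<Sum>t\<in>?T. (\<lambda>a. c (unit_vec t) * unit_vec t a)) b"
      unfolding c by (metis zero_fun_def)
    also have "\<dots> = (\<Sum>t\<in>?T. c (unit_vec t) * unit_vec t b)"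
      by (rule sum_fun_apply)
    also have "\<dots> = (\<Sum>t\<in>?T. if t = b then c (unit_vec b) else 0)"
      by (rule sum.cong) (auto simp: unit_vec_def)
    also have "\<dots> = c x"
      using b by simp
    finally show "c x = 0" ..
  qed
  then have "kvec.dim (tensor_mod F i j) = card ?B"
    using kvec.basis_card_eq_dim[OF sub span] by simp
  then show ?thesis
    by (simp add: vec_dim_def num_gens_def card_image[OF inj])
qed

lemma vec_dim_zero: "vec_dim {0 :: nat \<Rightarrow> 'k::field} = 0"
  unfolding vec_dim_def
  by (metis kvec.dim_span kvec.span_empty kvec.dim_eq_card_independent kvec.independent_empty card.empty)

lemma homology_dim_minimal:
  fixes F :: "('n, 'k::field) mpoly free_cpx"
  assumes "minimal F"
  shows "homology_dim F i j = num_gens F i j"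
proof -
  have zero: "tensor_diff F i v = 0" for i v
    using assms by (auto simp: tensor_diff_def mat_map_def minimal_def fun_eq_iff)
  have "tensor_cycles F i j = tensor_mod F i j"
    by (cases i) (auto simp: tensor_cycles_eq zero)
  moreover have "tensor_boundaries F i j = {0}"
    using kvec.subspace_0[OF tensor_mod_subspace] by (auto simp: tensor_boundaries_def zero)
  ultimately show ?thesis
    by (simp add: homology_dim_def vec_dim_tensor_mod vec_dim_zero)
qed

subsection \<open>Mapping cones\<close>

text \<open>The block matrix with rows \<open>(A B)\<close> and \<open>(0 D)\<close>, where
  \<open>A\<close> has \<open>s\<close> rows and \<open>r\<close> columns.\<close>

definition block :: "nat \<Rightarrow> nat \<Rightarrow> (nat \<Rightarrow> nat \<Rightarrow> 'a) \<Rightarrow> (nat \<Rightarrow> nat \<Rightarrow> 'a) \<Rightarrow> (nat \<Rightarrow> nat \<Rightarrow> 'a) \<Rightarrow>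
    nat \<Rightarrow> nat \<Rightarrow> 'a::zero" where
  "block r s A B D = (\<lambda>a b.
     if b < r then (if a < s then A a b else 0) else (if a < s then B a (b - r) else D (a - s) (b - r)))"

definition join :: "nat \<Rightarrow> (nat \<Rightarrow> 'a) \<Rightarrow> (nat \<Rightarrow> 'a) \<Rightarrow> nat \<Rightarrow> 'a" where
  "join r u v = (\<lambda>b. if b < r then u b else v (b - r))"

lemma sum_lessThan_add: "(\<Sum>b<r + (s::nat). f b) = (\<Sum>b<r. f b) + (\<Sum>b<s. f (r + b) :: 'a::comm_monoid_add)"
  by (induction s) (simp_all add: add.assoc)

lemma mat_map_block:
  "mat_map (r + r') (s + s') (block r s A B D) (join r u v) =
     join s (mat_map r s A u + mat_map r' s B v) (mat_map r' s' D v)"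
proof (rule ext)
  fix a
  show "mat_map (r + r') (s + s') (block r s A B D) (join r u v) a =
     join s (mat_map r s A u + mat_map r' s B v) (mat_map r' s' D v) a"
    by (cases "a < s") (auto simp: mat_map_def block_def join_def sum_lessThan_add)
qed

lemma join_free_mod: "v \<in> free_mod s \<Longrightarrow> join r u v \<in> free_mod (r + s)"
  by (auto simp: join_def free_mod_def)

lemma join_cases:
  assumes "w \<in> free_mod (r + s)"
  obtains u v where "u \<in> free_mod r" "v \<in> free_mod s" "w = join r u v"
proof (rule that)
  show "(\<lambda>b. if b < r then w b else 0) \<in> free_mod r" "(\<lambda>b. w (r + b)) \<in> free_mod s"
    using assms by (auto simp: free_mod_def)
  show "w = join r (\<lambda>b. if b < r then w b else 0) (\<lambda>b. w (r + b))"
    by (auto simp: join_def fun_eq_iff)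
qed

lemma join_eq_iff:
  assumes "u \<in> free_mod r" "u' \<in> free_mod r"
  shows "join r u v = join r u' v' \<longleftrightarrow> u = u' \<and> v = v'"
proof
  assume eq: "join r u v = join r u' v'"
  have "u b = u' b" for b
    using fun_cong[OF eq, of b] assms by (cases "b < r") (auto simp: join_def free_mod_def)
  moreover have "v b = v' b" for b
    using fun_cong[OF eq, of "r + b"] by (simp add: join_def)
  ultimately show "u = u' \<and> v = v'" by auto
qed auto

definition prev_rank :: "('n, 'k::field) mpoly free_cpx \<Rightarrow> nat \<Rightarrow> nat" where
  "prev_rank F i = (case i of 0 \<Rightarrow> 0 | Suc k \<Rightarrow> free_rank F k)"

text \<open>The cone of multiplication by \<open>f\<close> has the differential \<open>(u, v) \<mapsto> (du + fv, -dv)\<close>. In position \<open>0\<close>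
  its second summand is empty, so the values at the truncated index \<open>0 - 1\<close> are irrelevant.\<close>

definition cone :: "('n, 'k::field) mpoly \<Rightarrow> int \<Rightarrow> ('n, 'k) mpoly free_cpx \<Rightarrow> ('n, 'k) mpoly free_cpx" where
  "cone f d F = \<lparr>free_rank = \<lambda>i. free_rank F i + prev_rank F i,
     gen_deg = \<lambda>i. join (free_rank F i) (gen_deg F i) (\<lambda>b. gen_deg F (i - 1) b + d),
     dmat = \<lambda>i. block (free_rank F (Suc i)) (free_rank F i) (dmat F i)
       (\<lambda>a b. if a = b then f else 0) (\<lambda>a b. - dmat F (i - 1) a b),
     aug = aug F\<rparr>"

lemma mat_map_uminus: "mat_map r s (\<lambda>a b. - A a b) v = - mat_map r s A v"
  by (rule ext) (simp add: mat_map_def sum_negf)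

lemma mat_map_scalar:
  assumes "v \<in> free_mod r"
  shows "mat_map r r (\<lambda>a b. if a = b then f else 0) v = (\<lambda>b. f * v b)"
proof (rule ext)
  fix a
  have "(\<Sum>b<r. (if a = b then f else 0) * v b) = (\<Sum>b<r. if a = b then f * v a else 0)"
    by (rule sum.cong) auto
  then show "mat_map r r (\<lambda>a b. if a = b then f else 0) v a = f * v a"
    using assms by (auto simp: mat_map_def free_mod_def)
qed

lemma cone_diff_0:
  assumes "v \<in> free_mod (free_rank F 0)"
  shows "cpx_diff (cone f d F) 0 (join (free_rank F (Suc 0)) u v) = cpx_diff F 0 u + (\<lambda>b. f * v b)"
proof -
  have "cpx_diff (cone f d F) 0 (join (free_rank F (Suc 0)) u v) =
      join (free_rank F 0) (cpx_diff F 0 u + (\<lambda>b. f * v b)) 0"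
    unfolding cpx_diff_def cone_def
    by (simp add: prev_rank_def mat_map_block mat_map_scalar[OF assms] mat_map_def[of _ 0] flip: zero_fun_def)
       \<comment> \<open>The target rank \<open>free_rank F 0 + 0\<close> has been simplified to
         \<open>free_rank F 0\<close>, so the block formula is needed in its instance
         \<open>s' = 0\<close>.\<close>
       (simp add: mat_map_block[where s' = 0, simplified] mat_map_scalar[OF assms] mat_map_def[of _ 0] zero_fun_def)
  also have "\<dots> = cpx_diff F 0 u + (\<lambda>b. f * v b)"
    using assms cpx_diff_free_mod[of F 0 u] by (auto simp: join_def free_mod_def fun_eq_iff)
  finally show ?thesis .
qed

lemma cone_diff_Suc:
  assumes "v \<in> free_mod (free_rank F (Suc k))"
  shows "cpx_diff (cone f d F) (Suc k) (join (free_rank F (Suc (Suc k))) u v) =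
    join (free_rank F (Suc k)) (cpx_diff F (Suc k) u + (\<lambda>b. f * v b)) (- cpx_diff F k v)"
  unfolding cpx_diff_def cone_def
  by (simp add: prev_rank_def mat_map_block mat_map_scalar[OF assms] mat_map_uminus)

lemma ex_free_mod_add_iff:
  "(\<exists>w\<in>free_mod (r + s). P w) \<longleftrightarrow> (\<exists>u\<in>free_mod r. \<exists>v\<in>free_mod s. P (join r u v))"
  using join_free_mod join_cases by metis

lemma cone_simps:
  "free_rank (cone f d F) 0 = free_rank F 0"
  "free_rank (cone f d F) (Suc k) = free_rank F (Suc k) + free_rank F k"
  "cpx_aug (cone f d F) = cpx_aug F"
  "aug (cone f d F) = aug F"
  "gen_deg (cone f d F) 0 b = (if b < free_rank F 0 then gen_deg F 0 b else gen_deg F 0 (b - free_rank F 0) + d)"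
  "gen_deg (cone f d F) (Suc k) = join (free_rank F (Suc k)) (gen_deg F (Suc k)) (\<lambda>b. gen_deg F k b + d)"
  by (simp_all add: cone_def prev_rank_def cpx_aug_def join_def fun_eq_iff)

text \<open>The shift of the second summand by \<open>d\<close> gives the entries \<open>f\<close>,
  which join a generator to its copy, the right degree.\<close>

lemma cone_hmap:
  assumes F: "\<And>i. hmap F (Suc i) F i (dmat F i)" and f: "homogeneous d f"
  shows "hmap (cone f d F) (Suc i) (cone f d F) i (dmat (cone f d F) i)"
  unfolding hmat_def
proof (intro allI impI)
  fix a b assume a: "a < free_rank (cone f d F) i" and b: "b < free_rank (cone f d F) (Suc i)"
  show "homogeneous (gen_deg (cone f d F) (Suc i) b - gen_deg (cone f d F) i a) (dmat (cone f d F) i a b)"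
  proof (cases i)
    case 0
    then show ?thesis
      using F[of 0] f a b
      by (auto simp: cone_simps cone_def block_def join_def hmat_def homogeneous_zero prev_rank_def)
  next
    case (Suc k)
    have "homogeneous (gen_deg F (Suc k) b' - gen_deg F k a') (dmat F k a' b')"
      if "a' < free_rank F k" "b' < free_rank F (Suc k)" for a' b'
      using F[of k] that by (simp add: hmat_def)
    then show ?thesis
      using F[of "Suc k"] f a b unfolding Suc
      by (auto simp: cone_simps cone_def block_def join_def hmat_def homogeneous_zero prev_rank_def
        intro!: homogeneous_uminus)
  qed
qed

lemma cpx_diff_scale: "cpx_diff F k (\<lambda>b. c * v b) = (\<lambda>b. c * cpx_diff F k v b)"
  by (simp add: cpx_diff_def mat_map_scale)

lemma cpx_diff_add: "cpx_diff F k (u + v) = cpx_diff F k u + cpx_diff F k v"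
  by (simp add: cpx_diff_def mat_map_add)

lemma cpx_diff_uminus: "cpx_diff F k (- v) = - cpx_diff F k v"
  using mat_map_diff[of _ _ _ 0 v] by (simp add: cpx_diff_def mat_map_zero)

lemma free_mod_uminus: "v \<in> free_mod r \<Longrightarrow> - v \<in> free_mod r"
  by (simp add: free_mod_def)

text \<open>The long exact sequence of the cone, carried out on elements. The homology in position 0
  is \<open>S/V\<close> modulo \<open>f\<close>; that in position 1 is the kernel of multiplication
  by \<open>f\<close> on \<open>S/V\<close>, which \<open>reg\<close> makes zero.\<close>

lemma cone_resolution:
  assumes F: "graded_free_resolution F UNIV (ideal_of B)"
    and f: "homogeneous d f" and reg: "\<And>g. g * f \<in> ideal_of B \<Longrightarrow> g \<in> ideal_of B"
    and graded: "graded_ideal (ideal_of (insert f B))"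
  shows "graded_free_resolution (cone f d F) UNIV (ideal_of (insert f B))"
proof -
  let ?G = "cone f d F" and ?V = "ideal_of B" and ?W = "ideal_of (insert f B)"
  let ?r = "free_rank F"
  have fW: "f * x \<in> ?W" for x
    using ideal_of_mult[OF ideal_of_base, of f "insert f B" x] by (simp add: mult.commute)
  have VW: "?V \<subseteq> ?W"
    by (rule ideal_of_mono) auto
  have FD: "cyc F ?V k (cpx_diff F k u)" if "u \<in> free_mod (?r (Suc k))" for k u
    by (rule res_cyc[OF F that])
  have ex: "\<exists>u\<in>free_mod (?r (Suc k)). cpx_diff F k u = v" if "v \<in> free_mod (?r k)" "cyc F ?V k v" for k v
    using res_cyc_iff[OF F] that by blast
  have "cyc ?G ?W i w \<longleftrightarrow> (\<exists>u\<in>free_mod (free_rank ?G (Suc i)). cpx_diff ?G i u = w)" (is "?L \<longleftrightarrow> ?R")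
    if w: "w \<in> free_mod (free_rank ?G i)" for i w
  proof (cases i)
    case 0
    have w0: "w \<in> free_mod (?r 0)"
      using w 0 by (simp add: cone_simps)
    show ?thesis
    proof
      assume ?L
      \<comment> \<open>\<open>y\<close> is lifted to \<open>v\<close> along the augmentation of
        \<open>F\<close>; subtracting \<open>f v\<close> from \<open>w\<close> leaves a cycle of
        \<open>F\<close>, hence a boundary.\<close>
      then obtain y where y: "cpx_aug F w - y * f \<in> ?V"
        by (auto simp: 0 cyc_0 cone_simps ideal_of_insert_iff)
      obtain v where v: "v \<in> free_mod (?r 0)" "y - cpx_aug F v \<in> ?V"
        using res_surj[OF F] by blast
      have "cpx_aug F w - y * f + f * (y - cpx_aug F v) \<in> ?V"
        by (intro ideal_of_add y ideal_of_mult v(2))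
      then have "cyc F ?V 0 (w - (\<lambda>b. f * v b))"
        by (simp add: cyc_0 cpx_aug_diff cpx_aug_scale right_diff_distrib mult.commute)
      then obtain u where u: "u \<in> free_mod (?r (Suc 0))" "cpx_diff F 0 u = w - (\<lambda>b. f * v b)"
        using ex[OF free_mod_diff[OF w0 free_mod_scale[OF v(1)]]] by blast
      have "cpx_diff ?G 0 (join (?r (Suc 0)) u v) = w"
        unfolding cone_diff_0[OF v(1)] u(2) by (rule diff_add_cancel)
      moreover have "join (?r (Suc 0)) u v \<in> free_mod (free_rank ?G (Suc 0))"
        unfolding cone_simps by (rule join_free_mod[OF v(1)])
      ultimately show ?R
        unfolding 0 by blast
    next
      assume ?R
      then obtain u v where uv: "u \<in> free_mod (?r (Suc 0))" "v \<in> free_mod (?r 0)"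
        "cpx_diff ?G 0 (join (?r (Suc 0)) u v) = w"
        unfolding 0 cone_simps ex_free_mod_add_iff by blast
      have "cpx_aug F (cpx_diff F 0 u) + f * cpx_aug F v \<in> ?W"
        using FD[OF uv(1)] VW fW by (intro ideal_of_add) (auto simp: cyc_0)
      then show ?L
        unfolding 0 cyc_0 cone_simps uv(3)[symmetric] cone_diff_0[OF uv(2)]
        by (simp add: cpx_aug_add cpx_aug_scale)
    qed
  next
    case (Suc k)
    obtain u v where uv: "u \<in> free_mod (?r (Suc k))" "v \<in> free_mod (?r k)" "w = join (?r (Suc k)) u v"
      using w unfolding Suc cone_simps by (rule join_cases)
    have fv: "(\<lambda>b. f * v b) \<in> free_mod (?r k)"
      by (rule free_mod_scale[OF uv(2)])
    show ?thesis
    proof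
      assume L: ?L
      \<comment> \<open>The second component of a cycle is itself a cycle of \<open>F\<close>. For
        \<open>k > 0\<close> the second component of the differential says so; for
        \<open>k = 0\<close> it is regularity, as \<open>f\<close> times the augmentation of
        \<open>v\<close> lies in \<open>V\<close>.\<close>
      have eq: "cpx_diff F k u + (\<lambda>b. f * v b) = 0" "cyc F ?V k v"
      proof -
        have "cpx_diff F k u + (\<lambda>b. f * v b) = 0 \<and> cyc F ?V k v"
        proof (cases k)
          case 0
          have eq: "cpx_diff F 0 u + (\<lambda>b. f * v b) = 0"
            using L unfolding Suc 0 cyc_Suc uv(3) cone_diff_0[OF uv(2)[unfolded 0]] .
          have "cpx_aug F (cpx_diff F 0 u + (\<lambda>b. f * v b)) = 0"
            unfolding eq by (simp add: cpx_aug_def)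
          then have "cpx_aug F v * f = 0 - cpx_aug F (cpx_diff F 0 u)"
            by (simp add: cpx_aug_add cpx_aug_scale eq_neg_iff_add_eq_0 add.commute mult.commute)
          also have "\<dots> \<in> ?V"
            using FD[of u 0] uv(1) 0 by (intro ideal_of_diff ideal_of_zero) (simp add: cyc_0)
          finally have "cpx_aug F v \<in> ?V"
            by (rule reg)
          with eq show ?thesis
            by (simp add: 0 cyc_0)
        next
          case (Suc l)
          have "join (?r k) (cpx_diff F k u + (\<lambda>b. f * v b)) (- cpx_diff F l v) = 0"
            using L unfolding \<open>i = Suc k\<close> Suc cyc_Suc uv(3) cone_diff_Suc[OF uv(2)[unfolded Suc]] .
          also have "0 = join (?r k) 0 0"
            by (rule ext) (simp add: join_def)
          finally have "cpx_diff F k u + (\<lambda>b. f * v b) = 0 \<and> - cpx_diff F l v = 0"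
            by (subst (asm) join_eq_iff[OF free_mod_add[OF cpx_diff_free_mod fv]]) (simp_all add: free_mod_def)
          then show ?thesis
            by (simp add: Suc cyc_Suc)
        qed
        then show "cpx_diff F k u + (\<lambda>b. f * v b) = 0" "cyc F ?V k v" by auto
      qed
      \<comment> \<open>With \<open>v = d v'\<close> the element \<open>u + f v'\<close> is a cycle,
        hence equal to some \<open>d u'\<close>. The sign in the cone makes
        \<open>(u', - v')\<close> the preimage.\<close>
      obtain v' where v': "v' \<in> free_mod (?r (Suc k))" "cpx_diff F k v' = v"
        using ex[OF uv(2) eq(2)] by blast
      have "cyc F ?V (Suc k) (u + (\<lambda>b. f * v' b))"
        using eq(1) by (simp only: cyc_Suc cpx_diff_add cpx_diff_scale v'(2))
      then obtain u' where u': "u' \<in> free_mod (?r (Suc (Suc k)))" "cpx_diff F (Suc k) u' = u + (\<lambda>b. f * v' b)"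
        using ex[OF free_mod_add[OF uv(1) free_mod_scale[OF v'(1)]]] by blast
      have "u = cpx_diff F (Suc k) u' + (\<lambda>b. f * (- v') b)"
        unfolding u'(2) by (simp add: fun_eq_iff)
      moreover have "v = - cpx_diff F k (- v')"
        by (simp add: cpx_diff_uminus v'(2))
      ultimately have "cpx_diff ?G (Suc k) (join (?r (Suc (Suc k))) u' (- v')) = w"
        unfolding cone_diff_Suc[OF free_mod_uminus[OF v'(1)]] uv(3) by simp
      moreover have "join (?r (Suc (Suc k))) u' (- v') \<in> free_mod (free_rank ?G (Suc (Suc k)))"
        unfolding cone_simps by (rule join_free_mod[OF free_mod_uminus[OF v'(1)]])
      ultimately show ?R
        unfolding Suc by blast
    next
      assume ?R
      then obtain u' v' where uv': "u' \<in> free_mod (?r (Suc (Suc k)))" "v' \<in> free_mod (?r (Suc k))"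
        "cpx_diff ?G (Suc k) (join (?r (Suc (Suc k))) u' v') = w"
        unfolding Suc cone_simps ex_free_mod_add_iff by blast
      have "join (?r (Suc k)) u v = join (?r (Suc k)) (cpx_diff F (Suc k) u' + (\<lambda>b. f * v' b)) (- cpx_diff F k v')"
        using uv'(3) unfolding uv(3) cone_diff_Suc[OF uv'(2)] ..
      then have u: "u = cpx_diff F (Suc k) u' + (\<lambda>b. f * v' b)" and v: "v = - cpx_diff F k v'"
        by (simp_all only: join_eq_iff[OF uv(1) free_mod_add[OF cpx_diff_free_mod free_mod_scale[OF uv'(2)]]])
      \<comment> \<open>The cone differential squares to zero: the term \<open>f (d v')\<close>
        arises once from each component, with opposite signs.\<close>
      have "cpx_diff F k (cpx_diff F (Suc k) u') = 0"
        using FD[OF uv'(1)] by (simp add: cyc_Suc)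
      then have eq: "cpx_diff F k u + (\<lambda>b. f * v b) = 0"
        unfolding u v cpx_diff_add cpx_diff_scale by (simp add: fun_eq_iff)
      have eq': "cpx_diff F l v = 0" if "k = Suc l" for l
        using FD[OF uv'(2)] unfolding v that by (simp add: cyc_Suc cpx_diff_uminus)
      have "cpx_diff ?G k w = 0"
      proof (cases k)
        case 0
        show ?thesis
          using eq unfolding 0 uv(3) cone_diff_0[OF uv(2)[unfolded 0]] .
      next
        case (Suc l)
        have "cpx_diff ?G k w = join (?r k) 0 (- 0)"
          using eq eq'[OF Suc] unfolding Suc uv(3) cone_diff_Suc[OF uv(2)[unfolded Suc]] by (simp only:)
        also have "\<dots> = 0"
          by (rule ext) (simp add: join_def)
        finally show ?thesis .
      qed
      then show ?L
        by (simp add: Suc cyc_Suc)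
    qed
  qed
  moreover have "\<exists>v\<in>free_mod (?r 0). u - cpx_aug F v \<in> ?W" for u
    using res_surj[OF F, of u] VW by auto
  moreover have "hmap ?G (Suc i) ?G i (dmat ?G i)" for i
    by (rule cone_hmap[OF res_dmat[OF F] f])
  ultimately show ?thesis
    unfolding graded_free_resolution_iff
    using graded_ideal_UNIV graded res_aug_hom[OF F] by (simp add: cone_simps)
qed

lemma cone_minimal:
  assumes "minimal F" "Poly_Mapping.lookup f 0 = 0"
  shows "minimal (cone f d F)"
  unfolding minimal_def
proof (intro allI impI)
  fix i a b assume ab: "a < free_rank (cone f d F) i" "b < free_rank (cone f d F) (Suc i)"
  then show "Poly_Mapping.lookup (dmat (cone f d F) i a b) 0 = 0"
  proof (cases i)
    case 0
    then show ?thesis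
      using assms ab by (auto simp: cone_simps cone_def block_def minimal_def prev_rank_def)
  next
    case (Suc k)
    have "Poly_Mapping.lookup (dmat F k a' b') 0 = 0" if "a' < free_rank F k" "b' < free_rank F (Suc k)" for a' b'
      using assms(1) that by (simp add: minimal_def)
    then show ?thesis
      using assms ab unfolding Suc by (auto simp: cone_simps cone_def block_def minimal_def prev_rank_def)
  qed
qed

lemma cone_num_gens_0: "num_gens (cone f d F) 0 j = num_gens F 0 j"
  unfolding num_gens_def by (rule arg_cong[where f = card]) (auto simp: cone_simps)

lemma cone_num_gens_Suc: "num_gens (cone f d F) (Suc k) j = num_gens F (Suc k) j + num_gens F k (j - d)"
proof -
  let ?r = "free_rank F (Suc k)"
  let ?A = "{b. b < ?r \<and> gen_deg F (Suc k) b = j}" and ?B = "{b. b < free_rank F k \<and> gen_deg F k b = j - d}"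
  have "{b. b < free_rank (cone f d F) (Suc k) \<and> gen_deg (cone f d F) (Suc k) b = j} = ?A \<union> (+) ?r ` ?B"
    (is "?C = _")
  proof (intro set_eqI iffI)
    fix b assume b: "b \<in> ?C"
    show "b \<in> ?A \<union> (+) ?r ` ?B"
    proof (cases "b < ?r")
      case False
      then have "b - ?r \<in> ?B"
        using b by (auto simp: cone_simps join_def)
      then show ?thesis
        using False by (intro UnI2 image_eqI[of _ _ "b - ?r"]) auto
    qed (use b in \<open>auto simp: cone_simps join_def\<close>)
  qed (auto simp: cone_simps join_def)
  moreover have "card (?A \<union> (+) ?r ` ?B) = card ?A + card ((+) ?r ` ?B)"
    by (rule card_Un_disjoint) auto
  moreover have "card ((+) ?r ` ?B) = card ?B"
    by (rule card_image) simp
  ultimately show ?thesis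
    by (simp add: num_gens_def)
qed

subsection \<open>The Koszul resolution\<close>

definition subset_count :: "(nat \<Rightarrow> int) \<Rightarrow> nat \<Rightarrow> nat \<Rightarrow> int \<Rightarrow> nat" where
  "subset_count d p k j = card {A. A \<subseteq> {..<p} \<and> card A = k \<and> sum d A = j}"

lemma finite_subsets: "finite {A. A \<subseteq> {..<p::nat} \<and> P A}"
  by (rule finite_subset[of _ "Pow {..<p}"]) auto

lemma subset_count_0: "subset_count d p 0 j = (if j = 0 then 1 else 0)"
proof -
  have "{A. A \<subseteq> {..<p} \<and> card A = 0 \<and> sum d A = j} = (if j = 0 then {{}} else {})"
    by (auto dest: finite_subset)
  then show ?thesis
    by (simp add: subset_count_def)
qed

lemma subset_count_empty: "subset_count d 0 (Suc k) j = 0"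
  by (auto simp: subset_count_def)

text \<open>The subsets are sorted by whether they contain \<open>p\<close>. The recursion is that
  of \<open>cone_num_gens_Suc\<close>.\<close>

lemma subset_count_Suc:
  "subset_count d (Suc p) (Suc k) j = subset_count d p (Suc k) j + subset_count d p k (j - d p)"
proof -
  let ?A = "{A. A \<subseteq> {..<p} \<and> card A = Suc k \<and> sum d A = j}"
  let ?B = "{A. A \<subseteq> {..<p} \<and> card A = k \<and> sum d A = j - d p}"
  have fin: "finite A" if "A \<subseteq> {..<p}" for A
    using that finite_subset by blast
  have "{A. A \<subseteq> {..<Suc p} \<and> card A = Suc k \<and> sum d A = j} = ?A \<union> insert p ` ?B" (is "?C = _")
  proof (intro set_eqI iffI)
    fix A assume A: "A \<in> ?C"
    show "A \<in> ?A \<union> insert p ` ?B"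
    proof (cases "p \<in> A")
      case True
      have "A - {p} \<subseteq> {..<p}" "finite A"
        using A by (auto simp: lessThan_Suc intro: finite_subset)
      then have "A - {p} \<in> ?B"
        using A True by (simp add: sum_diff1)
      then show ?thesis
        using True by (intro UnI2 image_eqI[of _ _ "A - {p}"]) auto
    next
      case False
      then show ?thesis
        using A by (auto simp: lessThan_Suc)
    qed
  next
    fix A assume "A \<in> ?A \<union> insert p ` ?B"
    then show "A \<in> ?C"
    proof
      assume "A \<in> insert p ` ?B"
      then obtain B where B: "B \<subseteq> {..<p}" "card B = k" "sum d B = j - d p" "A = insert p B"
        by auto
      moreover from B have "p \<notin> B" "finite B"
        using fin by auto
      ultimately show ?thesis
        by (auto simp: lessThan_Suc)
    qed (auto simp: lessThan_Suc)
  qed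
  moreover have "card (?A \<union> insert p ` ?B) = card ?A + card (insert p ` ?B)"
    by (rule card_Un_disjoint) (auto simp: finite_subsets)
  moreover have "card (insert p ` ?B) = card ?B"
  proof (rule card_image, rule inj_onI)
    fix A B assume *: "A \<in> ?B" "B \<in> ?B" "insert p A = insert p B"
    then have "p \<notin> A" "p \<notin> B" by auto
    with *(3) show "A = B" by (simp add: insert_ident)
  qed
  ultimately show ?thesis
    by (simp add: subset_count_def)
qed

text \<open>The resolution of \<open>S\<close> by itself, the Koszul complex of the empty
  sequence.\<close>

definition trivial_cpx :: "('n, 'k::field) mpoly free_cpx" where
  "trivial_cpx = \<lparr>free_rank = (\<lambda>i. if i = 0 then 1 else 0), gen_deg = (\<lambda>_ _. 0),
     dmat = (\<lambda>_ _ _. 0), aug = (\<lambda>_. 1)\<rparr>"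

lemma graded_ideal_homogeneous: "(\<And>b. b \<in> B \<Longrightarrow> \<exists>d. homogeneous d b) \<Longrightarrow> graded_ideal (ideal_of B)"
  unfolding graded_ideal_def by blast

lemma free_mod_0: "free_mod 0 = {0}"
  by (auto simp: free_mod_def zero_fun_def)

lemma trivial_resolution: "graded_free_resolution trivial_cpx UNIV (ideal_of {} :: ('n::finite, 'k::field) mpoly set)"
proof -
  let ?F = "trivial_cpx :: ('n, 'k) mpoly free_cpx"
  have "cyc ?F {0} i v \<longleftrightarrow> (\<exists>u\<in>free_mod (free_rank ?F (Suc i)). cpx_diff ?F i u = v)"
    if "v \<in> free_mod (free_rank ?F i)" for i v
  proof (cases i)
    case 0
    have "v = 0 \<longleftrightarrow> v 0 = 0"
    proof
      assume v0: "v 0 = 0"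
      show "v = 0"
      proof
        fix b show "v b = 0 b"
          using v0 that 0 by (cases b) (auto simp: trivial_cpx_def free_mod_def)
      qed
    qed simp
    then show ?thesis
      by (auto simp: 0 cyc_0 cpx_aug_def trivial_cpx_def free_mod_0 cpx_diff_def mat_map_zero)
  next
    case (Suc k)
    then show ?thesis
      using that by (auto simp: cyc_Suc trivial_cpx_def free_mod_0 cpx_diff_def mat_map_zero)
  qed
  moreover have "\<exists>v\<in>free_mod (free_rank ?F 0). u - cpx_aug ?F v = 0" for u
    by (rule bexI[of _ "\<lambda>b. if b = 0 then u else 0"]) (auto simp: cpx_aug_def trivial_cpx_def free_mod_def)
  moreover have "graded_ideal {0 :: ('n, 'k) mpoly}"
    using graded_ideal_homogeneous[of "{}"] by (simp add: ideal_of_empty)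
  moreover have "hmap ?F (Suc i) ?F i (dmat ?F i)" for i
    by (simp add: hmat_def trivial_cpx_def)
  ultimately show ?thesis
    unfolding graded_free_resolution_iff ideal_of_empty
    using graded_ideal_UNIV by (simp add: trivial_cpx_def homogeneous_one)
qed

text \<open>Regularity at position \<open>p\<close> is the hypothesis \<open>reg\<close> of
  \<open>cone_resolution\<close>. The clauses on \<open>free_rank F 0\<close> and
  \<open>aug F 0\<close> are carried along for the resolution of the ideal itself.\<close>

lemma koszul_resolution:
  fixes fs :: "('n::finite, 'k::field) mpoly list"
  assumes hom: "\<And>i. i < length fs \<Longrightarrow> homogeneous (d i) (fs ! i)"
    and const: "\<And>i. i < length fs \<Longrightarrow> Poly_Mapping.lookup (fs ! i) 0 = 0"
    and reg: "regular_sequence fs" and p: "p \<le> length fs"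
  shows "\<exists>F. graded_free_resolution F UNIV (ideal_of (set (take p fs))) \<and> minimal F \<and>
    free_rank F 0 = 1 \<and> aug F 0 = 1 \<and> (\<forall>k j. num_gens F k j = subset_count d p k j)"
  using p
proof (induction p)
  case 0
  let ?F = "trivial_cpx :: ('n, 'k) mpoly free_cpx"
  have "num_gens ?F k j = subset_count d 0 k j" for k j
  proof (cases k)
    case 0
    have "{b. b = 0 \<and> j = 0} = (if j = 0 then {0::nat} else {})" by auto
    with 0 show ?thesis
      by (auto simp: num_gens_def trivial_cpx_def subset_count_0)
  qed (auto simp: num_gens_def trivial_cpx_def subset_count_empty)
  moreover have "minimal ?F"
    by (simp add: minimal_def trivial_cpx_def)
  ultimately show ?case
    using trivial_resolution by (intro exI[of _ ?F]) (auto simp: trivial_cpx_def)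
next
  case (Suc p)
  then obtain F where F: "graded_free_resolution F UNIV (ideal_of (set (take p fs)))" "minimal F"
    "free_rank F 0 = 1" "aug F 0 = 1" "\<And>k j. num_gens F k j = subset_count d p k j"
    by auto
  have p: "p < length fs"
    using Suc.prems by simp
  have set: "set (take (Suc p) fs) = insert (fs ! p) (set (take p fs))"
    using p by (simp add: take_Suc_conv_app_nth)
  have "\<exists>d. homogeneous d f" if "f \<in> set (take (Suc p) fs)" for f
    using that hom by (metis in_set_conv_nth in_set_takeD)
  then have "graded_ideal (ideal_of (insert (fs ! p) (set (take p fs))))"
    unfolding set by (rule graded_ideal_homogeneous)
  then have "graded_free_resolution (cone (fs ! p) (d p) F) UNIV (ideal_of (set (take (Suc p) fs)))"
    unfolding set using reg p by (intro cone_resolution[OF F(1) hom[OF p]]) (auto simp: regular_sequence_def)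
  moreover have "num_gens (cone (fs ! p) (d p) F) k j = subset_count d (Suc p) k j" for k j
    by (cases k) (simp_all add: cone_num_gens_0 cone_num_gens_Suc F(5) subset_count_0 subset_count_Suc)
  ultimately show ?case
    using cone_minimal[OF F(2) const[OF p]] F(3,4)
    by (intro exI[of _ "cone (fs ! p) (d p) F"]) (simp add: cone_simps)
qed

section \<open>The resolution of the ideal, and the projective dimension\<close>

definition truncate_cpx :: "('n, 'k::field) mpoly free_cpx \<Rightarrow> ('n, 'k) mpoly free_cpx" where
  "truncate_cpx F = \<lparr>free_rank = \<lambda>i. free_rank F (Suc i), gen_deg = \<lambda>i. gen_deg F (Suc i),
     dmat = \<lambda>i. dmat F (Suc i), aug = dmat F 0 0\<rparr>"

text \<open>With \<open>F_0 = S\<close> augmented by the identity, the kernel of \<open>F_0\<close>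
  onto \<open>S/V\<close> is \<open>V\<close>, so the first differential becomes an augmentation
  onto \<open>V\<close> once \<open>F_0\<close> is dropped. Homological degrees fall by one,
  internal degrees stay.\<close>

lemma truncate_resolution:
  fixes F :: "('n::finite, 'k::field) mpoly free_cpx"
  assumes F: "graded_free_resolution F UNIV V" and rank: "free_rank F 0 = 1" and aug: "aug F 0 = 1"
  shows "graded_free_resolution (truncate_cpx F) V {0}"
proof -
  let ?T = "truncate_cpx F"
  have augF: "cpx_aug F v = v 0" for v
    by (simp add: cpx_aug_def rank aug)
  have simps: "free_rank ?T i = free_rank F (Suc i)" "gen_deg ?T i = gen_deg F (Suc i)"
    "dmat ?T i = dmat F (Suc i)" "aug ?T = dmat F 0 0" "cpx_diff ?T i = cpx_diff F (Suc i)" for i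
    by (simp_all add: truncate_cpx_def cpx_diff_def)
  have augT: "cpx_aug ?T v = cpx_diff F 0 v 0" for v
    by (simp add: cpx_aug_def cpx_diff_def mat_map_def simps rank)
  have diff0: "cpx_diff F 0 v = 0 \<longleftrightarrow> cpx_diff F 0 v 0 = 0" for v
    by (auto simp: cpx_diff_def mat_map_def rank fun_eq_iff)
  \<comment> \<open>A basis element sent to 1 has degree 0, so the entries of the first differential
    have the degrees of the generators of \<open>F_1\<close>.\<close>
  have "homogeneous (gen_deg F 0 0) (1 :: ('n, 'k) mpoly)"
    using res_aug_hom[OF F, of 0] rank aug by simp
  then have deg: "gen_deg F 0 0 = 0"
    by (auto simp: homogeneous_def mon_degree_zero)
  have "cyc ?T {0} i v \<longleftrightarrow> cyc F V (Suc i) v" for i v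
    by (cases i) (simp_all add: cyc_0 cyc_Suc augT simps diff0)
  then have "cyc ?T {0} i v \<longleftrightarrow> (\<exists>u\<in>free_mod (free_rank ?T (Suc i)). cpx_diff ?T i u = v)"
    if "v \<in> free_mod (free_rank ?T i)" for i v
    using res_cyc_iff[OF F] that by (simp add: simps)
  moreover have "dmat F 0 0 b \<in> V \<and> homogeneous (gen_deg F (Suc 0) b) (dmat F 0 0 b)" if "b < free_rank F (Suc 0)" for b
    using res_cyc[OF F unit_vec_free_mod[OF that]] res_dmat[OF F, of 0] that
    by (simp add: cyc_0 augF cpx_diff_def mat_map_unit_vec rank hmat_def deg)
  moreover have "\<exists>v\<in>free_mod (free_rank ?T 0). u - cpx_aug ?T v \<in> {0}" if "u \<in> V" for u
  proof -
    have "\<exists>v\<in>free_mod (free_rank F (Suc 0)). cpx_diff F 0 v = (\<lambda>b. if b = 0 then u else 0)"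
      using res_cyc_iff[OF F, of "\<lambda>b. if b = 0 then u else 0" 0] that
      by (simp add: cyc_0 augF free_mod_def rank)
    then obtain v where v: "v \<in> free_mod (free_rank F (Suc 0))" "cpx_diff F 0 v = (\<lambda>b. if b = 0 then u else 0)"
      by blast
    show ?thesis
      by (rule bexI[of _ v]) (use v in \<open>simp_all add: augT simps\<close>)
  qed
  moreover have "graded_ideal {0 :: ('n, 'k) mpoly}"
    using graded_ideal_homogeneous[of "{}"] by (simp add: ideal_of_empty)
  moreover obtain B where "V = ideal_of B"
    using graded_idealE[OF res_graded_V[OF F]] .
  then have "0 \<in> V"
    by (simp add: ideal_of_zero)
  moreover have "hmap ?T (Suc i) ?T i (dmat ?T i)" for i
    using res_dmat[OF F, of "Suc i"] by (simp add: simps)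
  ultimately show ?thesis
    unfolding graded_free_resolution_iff using res_graded_V[OF F] by (simp add: simps)
qed

theorem complete_intersection_betti:
  fixes fs :: "('n::finite, 'k::field) mpoly list"
  assumes hom: "\<forall>f\<in>set fs. \<exists>d. homogeneous d f" and reg: "regular_sequence fs"
  obtains d where "\<And>i. i < length fs \<Longrightarrow> d i > 0"
    "\<And>i j. betti i j UNIV (ideal_of (set fs)) = subset_count d (length fs) i j"
    "\<And>i j. betti i j (ideal_of (set fs)) {0} = subset_count d (length fs) (Suc i) j"
    "proj_dim UNIV (ideal_of (set fs)) = length fs"
proof -
  let ?p = "length fs" and ?I = "ideal_of (set fs)"
  define d where "d i = (SOME e. homogeneous e (fs ! i))" for i
  have d: "homogeneous (d i) (fs ! i)" if "i < ?p" for i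
    unfolding d_def by (rule someI_ex) (use hom that in simp)
  have proper: "?I \<noteq> UNIV"
    using reg by (simp add: regular_sequence_def)
  have pos: "d i > 0" if i: "i < ?p" for i
  proof (rule homogeneous_degree_pos[OF d[OF i] _ _ proper])
    show "fs ! i \<in> ?I"
      using i by (intro ideal_of_base) auto
    show "fs ! i \<noteq> 0"
    proof
      \<comment> \<open>A zero entry would have product 0 with 1, and regularity would put 1 into
        the ideal of the earlier entries.\<close>
      assume "fs ! i = 0"
      then have "1 * fs ! i \<in> ideal_of (set (take i fs))"
        by (simp add: ideal_of_zero)
      then have "1 \<in> ideal_of (set (take i fs))"
        using reg i unfolding regular_sequence_def by blast
      then have "1 \<in> ?I"
        using ideal_of_mono[OF set_take_subset[of i fs]] by blast
      then show False
        using one_in_ideal_of proper by blast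
    qed
  qed
  have const: "Poly_Mapping.lookup (fs ! i) 0 = 0" if "i < ?p" for i
    using homogeneous_lookup_zero[OF d[OF that]] pos[OF that] by simp
  obtain F where F: "graded_free_resolution F UNIV ?I" "minimal F"
    "free_rank F 0 = 1" "aug F 0 = 1" "\<And>k j. num_gens F k j = subset_count d ?p k j"
    using koszul_resolution[OF d const reg order_refl] by auto
  have betti: "betti i j UNIV ?I = subset_count d ?p i j" for i j
    by (simp add: betti_eq_homology_dim[OF F(1)] homology_dim_minimal[OF F(2)] F(5))
  have bettiI: "betti i j ?I {0} = subset_count d ?p (Suc i) j" for i j
  proof -
    have "minimal (truncate_cpx F)"
      using F(2) by (simp add: minimal_def truncate_cpx_def)
    then have "betti i j ?I {0} = num_gens (truncate_cpx F) i j"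
      by (simp add: betti_eq_homology_dim[OF truncate_resolution[OF F(1,3,4)]] homology_dim_minimal)
    also have "\<dots> = num_gens F (Suc i) j"
      by (simp add: num_gens_def truncate_cpx_def)
    finally show ?thesis
      by (simp add: F(5))
  qed
  have "proj_dim UNIV ?I = ?p"
    unfolding proj_dim_def
  proof (rule Least_equality)
    have "free_rank F i = 0" if "i > ?p" for i
    proof (rule ccontr)
      assume "free_rank F i \<noteq> 0"
      then have "0 \<in> {b. b < free_rank F i \<and> gen_deg F i b = gen_deg F i 0}" by auto
      then have "num_gens F i (gen_deg F i 0) \<noteq> 0"
        unfolding num_gens_def by auto
      then have "\<exists>A. A \<subseteq> {..<?p} \<and> card A = i"
        unfolding F(5) subset_count_def by (metis (mono_tags, lifting) card.empty empty_Collect_eq)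
      with that show False
        using card_mono[of "{..<?p}"] by (metis card_lessThan finite_lessThan not_le)
    qed
    with F(1) show "\<exists>F. graded_free_resolution F UNIV ?I \<and> (\<forall>i>?p. free_rank F i = 0)"
      by (intro exI[of _ F]) simp
  next
    fix q assume "\<exists>G. graded_free_resolution G UNIV ?I \<and> (\<forall>i>q. free_rank G i = 0)"
    then obtain G where G: "graded_free_resolution G UNIV ?I" "\<And>i. i > q \<Longrightarrow> free_rank G i = 0"
      by blast
    \<comment> \<open>The set of all indices contributes to the Betti number in position
      \<open>p\<close>, which a shorter resolution would force to be 0.\<close>
    show "?p \<le> q"
    proof (rule ccontr)
      assume "\<not> ?p \<le> q"
      then have rank: "free_rank G ?p = 0"
        using G(2) by simp
      let ?j = "sum d {..<?p}"
      have "tensor_mod G ?p ?j \<subseteq> {0}"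
        using tensor_mod_subset[of G ?p ?j] by (simp add: rank free_mod_0)
      then have "tensor_cycles G ?p ?j = {0}"
        using tensor_cycles_subset[of G ?p ?j] kvec.subspace_0[OF tensor_cycles_subspace[of G ?p ?j]] by auto
      then have "homology_dim G ?p ?j = 0"
        by (simp add: homology_dim_def vec_dim_zero)
      then have "subset_count d ?p ?p ?j = 0"
        using betti_eq_homology_dim[OF G(1)] betti by metis
      moreover have "{..<?p} \<in> {A. A \<subseteq> {..<?p} \<and> card A = ?p \<and> sum d A = ?j}" by simp
      ultimately show False
        using finite_subsets[of ?p "\<lambda>A. card A = ?p \<and> sum d A = ?j"] unfolding subset_count_def
        by (metis (no_types, lifting) card_0_eq empty_iff)
    qed
  qed
  then show thesis
    using that pos betti bettiI by blast
qed

subsection \<open>Sums over subsets of fixed size\<close>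

definition subset_sums :: "(nat \<Rightarrow> int) \<Rightarrow> nat \<Rightarrow> nat \<Rightarrow> int set" where
  "subset_sums d p i = sum d ` {A. A \<subseteq> {..<p} \<and> card A = i}"

lemma finite_subset_sums: "finite (subset_sums d p i)"
  unfolding subset_sums_def by (rule finite_imageI[OF finite_subsets])

lemma subset_sumsI: "A \<subseteq> {..<p} \<Longrightarrow> card A = i \<Longrightarrow> sum d A \<in> subset_sums d p i"
  by (auto simp: subset_sums_def)

lemma subset_sums_nonempty: "i \<le> p \<Longrightarrow> subset_sums d p i \<noteq> {}"
  using subset_sumsI[of "{..<i}" p i d] by auto

lemma subset_sums_empty: "p < i \<Longrightarrow> subset_sums d p i = {}"
  unfolding subset_sums_def using card_mono[of "{..<p}"]
  by (metis (mono_tags, lifting) card_lessThan empty_Collect_eq finite_lessThan image_is_empty not_le)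

lemma subset_count_nonzero: "{j. subset_count d p i j \<noteq> 0} = subset_sums d p i"
proof -
  have "subset_count d p i j \<noteq> 0 \<longleftrightarrow> {A. A \<subseteq> {..<p} \<and> card A = i \<and> sum d A = j} \<noteq> {}" for j
    unfolding subset_count_def using finite_subsets[of p "\<lambda>A. card A = i \<and> sum d A = j"] by simp
  then show ?thesis
    by (auto simp: subset_sums_def)
qed

lemma sum_subset_count: "(\<Sum>j\<in>subset_sums d p i. subset_count d p i j) = p choose i"
proof -
  let ?S = "{A. A \<subseteq> {..<p} \<and> card A = i}"
  have "(\<Sum>A\<in>?S. 1) = (\<Sum>j\<in>sum d ` ?S. \<Sum>A\<in>{A \<in> ?S. sum d A = j}. 1::nat)"
    by (rule sum.image_gen[OF finite_subsets])
  also have "\<dots> = (\<Sum>j\<in>subset_sums d p i. subset_count d p i j)"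
    unfolding subset_sums_def subset_count_def by (intro sum.cong refl) (simp add: conj_assoc)
  finally show ?thesis
    using n_subsets[of "{..<p}" i] by simp
qed

lemma subset_sums_1: "i < p \<Longrightarrow> d i \<in> subset_sums d p (Suc 0)"
  using subset_sumsI[of "{i}" p "Suc 0" d] by simp

lemma subset_sums_full: "subset_sums d p p = {sum d {..<p}}"
proof -
  have "{A. A \<subseteq> {..<p} \<and> card A = p} = {{..<p}}"
    using card_subset_eq[of "{..<p}"] by auto
  then show ?thesis
    by (simp add: subset_sums_def)
qed

lemma subset_sums_const:
  assumes "\<And>t. t < p \<Longrightarrow> d t = c" "i \<le> p"
  shows "subset_sums d p i = {int i * c}"
proof -
  have "sum d A = int i * c" if "A \<subseteq> {..<p}" "card A = i" for A
  proof -
    have "sum d A = (\<Sum>t\<in>A. c)"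
      using that(1) assms(1) by (intro sum.cong) auto
    then show ?thesis by (simp add: that(2))
  qed
  then have "subset_sums d p i \<subseteq> {int i * c}"
    by (auto simp: subset_sums_def)
  then show ?thesis
    using subset_sums_nonempty[OF assms(2), of d] by blast
qed

text \<open>The smallest degree in a maximal set is at most the average, so removing it leaves at
  least the fraction \<open>i / (i + 1)\<close> of the sum.\<close>

lemma Max_subset_sums_step:
  assumes "i < p"
  shows "int i * Max (subset_sums d p (Suc i)) \<le> int (Suc i) * Max (subset_sums d p i)"
proof -
  have "Max (subset_sums d p (Suc i)) \<in> subset_sums d p (Suc i)"
    using assms by (intro Max_in finite_subset_sums subset_sums_nonempty) simp
  then obtain A where A: "A \<subseteq> {..<p}" "card A = Suc i" "sum d A = Max (subset_sums d p (Suc i))"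
    by (auto simp: subset_sums_def)
  then have fin: "finite A" "A \<noteq> {}"
    using finite_subset by auto
  have "Min (d ` A) \<in> d ` A"
    using fin by (intro Min_in) auto
  then obtain x where x: "x \<in> A" "d x = Min (d ` A)"
    by (metis imageE)
  then have min: "d x \<le> d y" if "y \<in> A" for y
    using fin that by simp
  have "int (Suc i) * d x \<le> sum d A"
    using sum_bounded_below[of A "d x" d] min A(2) by simp
  moreover have "sum d A - d x \<le> Max (subset_sums d p i)"
  proof (rule Max_ge[OF finite_subset_sums])
    have "sum d (A - {x}) \<in> subset_sums d p i"
      using A x(1) by (intro subset_sumsI) auto
    then show "sum d A - d x \<in> subset_sums d p i"
      using fin(1) x(1) by (simp add: sum_diff1)
  qed
  then have "int (Suc i) * (sum d A - d x) \<le> int (Suc i) * Max (subset_sums d p i)"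
    by (rule mult_left_mono) simp
  ultimately show ?thesis
    unfolding A(3) by (simp add: algebra_simps)
qed

lemma Min_subset_sums_step:
  assumes "i < p"
  shows "int i * Min (subset_sums d p (Suc i)) \<ge> int (Suc i) * Min (subset_sums d p i)"
proof -
  have "Min (subset_sums d p (Suc i)) \<in> subset_sums d p (Suc i)"
    using assms by (intro Min_in finite_subset_sums subset_sums_nonempty) simp
  then obtain A where A: "A \<subseteq> {..<p}" "card A = Suc i" "sum d A = Min (subset_sums d p (Suc i))"
    by (auto simp: subset_sums_def)
  then have fin: "finite A" "A \<noteq> {}"
    using finite_subset by auto
  have "Max (d ` A) \<in> d ` A"
    using fin by (intro Max_in) auto
  then obtain x where x: "x \<in> A" "d x = Max (d ` A)"
    by (metis imageE)
  then have max: "d y \<le> d x" if "y \<in> A" for y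
    using fin that by simp
  have "int (Suc i) * d x \<ge> sum d A"
    using sum_bounded_above[of A d "d x"] max A(2) by simp
  moreover have "sum d A - d x \<ge> Min (subset_sums d p i)"
  proof (rule Min_le[OF finite_subset_sums])
    have "sum d (A - {x}) \<in> subset_sums d p i"
      using A x(1) by (intro subset_sumsI) auto
    then show "sum d A - d x \<in> subset_sums d p i"
      using fin(1) x(1) by (simp add: sum_diff1)
  qed
  then have "int (Suc i) * Min (subset_sums d p i) \<le> int (Suc i) * (sum d A - d x)"
    by (rule mult_left_mono) simp
  ultimately show ?thesis
    unfolding A(3) by (simp add: algebra_simps)
qed

lemma Max_subset_sums_Suc:
  assumes "i < p" "\<And>t. t < p \<Longrightarrow> d t > 0"
  shows "Max (subset_sums d p i) + 1 \<le> Max (subset_sums d p (Suc i))"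
proof -
  have "Max (subset_sums d p i) \<in> subset_sums d p i"
    using assms by (intro Max_in finite_subset_sums subset_sums_nonempty) simp
  then obtain A where A: "A \<subseteq> {..<p}" "card A = i" "sum d A = Max (subset_sums d p i)"
    by (auto simp: subset_sums_def)
  then have fin: "finite A"
    using finite_subset by auto
  obtain x where x: "x < p" "x \<notin> A"
    using A(1,2) assms(1) by (metis card_lessThan lessThan_iff less_irrefl subsetI subset_antisym)
  have "sum d (insert x A) \<le> Max (subset_sums d p (Suc i))"
    using A x fin by (intro Max_ge[OF finite_subset_sums] subset_sumsI) auto
  then show ?thesis
    using fin x assms(2)[OF x(1)] A(3) by simp
qed

lemma Min_subset_sums_Suc:
  assumes "i < p" "\<And>t. t < p \<Longrightarrow> d t > 0"
  shows "Min (subset_sums d p i) + 1 \<le> Min (subset_sums d p (Suc i))"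
proof -
  have "Min (subset_sums d p (Suc i)) \<in> subset_sums d p (Suc i)"
    using assms by (intro Min_in finite_subset_sums subset_sums_nonempty) simp
  then obtain A where A: "A \<subseteq> {..<p}" "card A = Suc i" "sum d A = Min (subset_sums d p (Suc i))"
    by (auto simp: subset_sums_def)
  then have fin: "finite A"
    using finite_subset by auto
  obtain x where x: "x \<in> A"
    using A(2) by fastforce
  have "Min (subset_sums d p i) \<le> sum d (A - {x})"
    using A x by (intro Min_le[OF finite_subset_sums] subset_sumsI) auto
  moreover have "d x > 0"
    using A(1) x assms(2) by auto
  ultimately show ?thesis
    using fin x A(3) by (simp add: sum_diff1)
qed

subsection \<open>Products of shifts\<close>

lemma increasing_gap:
  fixes x :: "nat \<Rightarrow> real"
  assumes "\<And>i. i < p \<Longrightarrow> x i + 1 \<le> x (Suc i)" "j \<le> k" "k \<le> p"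
  shows "real k - real j \<le> x k - x j"
  using assms(2,3)
proof (induction k rule: dec_induct)
  case (step n)
  then show ?case using assms(1)[of n] by simp
qed simp

text \<open>Each step compares \<open>x i / i\<close> at neighbours. The sign of \<open>x\<close> is
  left open, so that the increasing ratio of the minimal shifts is covered by negation.\<close>

lemma decreasing_ratio:
  fixes x :: "nat \<Rightarrow> real"
  assumes "\<And>i. i < p \<Longrightarrow> real i * x (Suc i) \<le> real (Suc i) * x i" "1 \<le> j" "j \<le> k" "k \<le> p"
  shows "real j * x k \<le> real k * x j"
proof -
  have "x k / real k \<le> x j / real j"
    using assms(3,4)
  proof (induction k rule: dec_induct)
    case (step n)
    have "x (Suc n) / real (Suc n) \<le> x n / real n"
      using assms(1)[of n] step assms(2) by (simp add: field_simps)
    then show ?case using step by simp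
  qed simp
  then show ?thesis
    using assms(2,3) by (simp add: field_simps)
qed

text \<open>One product over all \<open>j\<close> other than \<open>i\<close> lets the bounds be
  compared factor by factor with \<open>prod_mono\<close>.\<close>

lemma prod_split:
  assumes "i \<in> {1..p}"
  shows "(\<Prod>j\<in>{1..<i}. f j) * (\<Prod>j\<in>{i<..p}. g j) = (\<Prod>j\<in>{1..p} - {i::nat}. if j < i then f j else g j :: real)"
proof -
  have J: "{1..p} - {i} = {1..<i} \<union> {i<..p}"
    using assms by auto
  have "(\<Prod>j\<in>{1..p} - {i}. if j < i then f j else g j) =
      (\<Prod>j\<in>{1..<i}. if j < i then f j else g j) * (\<Prod>j\<in>{i<..p}. if j < i then f j else g j)"
    unfolding J by (rule prod.union_disjoint) auto
  also have "\<dots> = (\<Prod>j\<in>{1..<i}. f j) * (\<Prod>j\<in>{i<..p}. g j)"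
    by (intro arg_cong2[where f = "(*)"] prod.cong) auto
  finally show ?thesis ..
qed

lemma distance_prod:
  assumes "i \<in> {1..p}"
  shows "(\<Prod>j\<in>{1..<i}. real i - real j) * (\<Prod>j\<in>{i<..p}. real j - real i) = fact (i - 1) * fact (p - i)"
proof -
  have "(\<Prod>j\<in>{1..<i}. real i - real j) = (\<Prod>k\<in>{1..i - 1}. real k)"
    by (rule prod.reindex_bij_witness[of _ "\<lambda>k. i - k" "\<lambda>k. i - k"]) auto
  moreover have "(\<Prod>j\<in>{i<..p}. real j - real i) = (\<Prod>k\<in>{1..p - i}. real k)"
    by (rule prod.reindex_bij_witness[of _ "\<lambda>k. k + i" "\<lambda>k. k - i"]) auto
  ultimately show ?thesis
    by (simp add: fact_prod)
qed

text \<open>The numerators multiply to \<open>p! / i\<close> and the denominators to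
  \<open>(i - 1)! (p - i)!\<close>. This is the shape of the first upper bound, with
  \<open>M j\<close> replaced by \<open>j\<close>.\<close>

lemma binomial_prod:
  assumes i: "i \<in> {1..p}"
  shows "real (p choose i) =
    (\<Prod>j\<in>{1..<i}. real j / (real i - real j)) * (\<Prod>j\<in>{i<..p}. real j / (real j - real i))"
proof -
  have "real i * (\<Prod>j\<in>{1..p} - {i}. real j) = fact p"
    using prod.remove[of "{1..p}" i real] i by (simp add: fact_prod)
  moreover have "(\<Prod>j\<in>{1..<i}. real j) * (\<Prod>j\<in>{i<..p}. real j) = (\<Prod>j\<in>{1..p} - {i}. real j)"
    unfolding prod_split[OF i] by (rule prod.cong) auto
  ultimately have N: "fact p = real i * ((\<Prod>j\<in>{1..<i}. real j) * (\<Prod>j\<in>{i<..p}. real j))"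
    by simp
  have "(fact i :: real) = real i * fact (i - 1)"
    using i fact_reduce[of i] by simp
  then have "real (p choose i) = real i * ((\<Prod>j\<in>{1..<i}. real j) * (\<Prod>j\<in>{i<..p}. real j)) /
      (real i * (fact (i - 1) * fact (p - i)))"
    using i by (simp only: binomial_fact N mult.assoc atLeastAtMost_iff)
  also have "\<dots> = ((\<Prod>j\<in>{1..<i}. real j) * (\<Prod>j\<in>{i<..p}. real j)) / (fact (i - 1) * fact (p - i))"
    using i by (intro mult_divide_mult_cancel_left) simp
  also have "\<dots> = (\<Prod>j\<in>{1..<i}. real j / (real i - real j)) * (\<Prod>j\<in>{i<..p}. real j / (real j - real i))"
    unfolding distance_prod[OF i, symmetric] by (simp add: prod_dividef)
  finally show ?thesis .
qed

text \<open>Were one factor strictly smaller, positivity of the others would keep the products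
  strictly apart. This extracts a single factor from an equality of bounds.\<close>

lemma prod_mono_eq:
  fixes f g :: "nat \<Rightarrow> real"
  assumes "finite J" "\<And>j. j \<in> J \<Longrightarrow> 0 < f j \<and> f j \<le> g j" "prod f J = prod g J" "k \<in> J"
  shows "f k = g k"
proof (rule ccontr)
  assume "f k \<noteq> g k"
  then have "f k < g k"
    using assms(2,4) by force
  moreover have "0 < prod f (J - {k})"
    using assms(2) by (intro prod_pos) auto
  moreover have "prod f (J - {k}) \<le> prod g (J - {k})"
    using assms(2) by (intro prod_mono) (auto intro: less_imp_le)
  moreover have "0 < f k"
    using assms(2,4) by auto
  ultimately have "f k * prod f (J - {k}) < g k * prod g (J - {k})"
    by (intro mult_less_le_imp_less) auto
  then show False
    using assms(1,3,4) by (simp add: prod.remove)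
qed

text \<open>The numbers \<open>c - d t\<close> are nonnegative and sum to zero.\<close>

lemma max_sum_extremal:
  assumes "real_of_int (sum d {..<p}) = real p * real_of_int c" "\<And>t. t < p \<Longrightarrow> d t \<le> c" "s < p"
  shows "d s = c"
proof -
  have "real_of_int (sum d {..<p}) = real_of_int (int p * c)"
    using assms(1) by simp
  then have "(\<Sum>t<p. c - d t) = 0"
    unfolding of_int_eq_iff by (simp add: sum_subtractf)
  then have "c - d s = 0"
    using sum_nonneg_eq_0_iff[of "{..<p}" "\<lambda>t. c - d t"] assms(2,3) by simp
  then show ?thesis by simp
qed

lemma min_sum_extremal:
  assumes "real_of_int (sum d {..<p}) = real p * real_of_int c" "\<And>t. t < p \<Longrightarrow> c \<le> d t" "s < p"
  shows "d s = c"
  using max_sum_extremal[of "\<lambda>t. - d t" p "- c" s] assms by (simp add: sum_negf)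

section \<open>The bounds and their equality cases\<close>

theorem theorem2p1:
  fixes fs :: "('n::finite, 'k::field) mpoly list"
    and I :: "('n, 'k) mpoly set"
    and p :: nat
    and \<beta> M m :: "nat \<Rightarrow> real"
  assumes p: "p = length fs" "p \<ge> 1"
    and hom: "\<forall>f\<in>set fs. \<exists>d. homogeneous d f"
    and reg: "regular_sequence fs"
    and I: "I = ideal_of (set fs)" "I \<noteq> UNIV"
    and \<beta>: "\<beta> = (\<lambda>i. real (total_betti i UNIV I))"
    and M: "M = (\<lambda>i. real_of_int (max_shift i UNIV I))"
    and m: "m = (\<lambda>i. real_of_int (min_shift i UNIV I))"
  shows
    "proj_dim UNIV I = p \<and>
     \<comment> \<open>(i)\<close>
     (\<forall>i\<in>{1..p}.
        \<beta> i \<le> (\<Prod>j\<in>{1..<i}. M j / (M i - M j)) * (\<Prod>j\<in>{i<..p}. M j / (M j - M i)) \<and>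
        (\<Prod>j\<in>{1..<i}. M j / (M i - M j)) * (\<Prod>j\<in>{i<..p}. M j / (M j - M i))
          \<le> 1 / (fact (i - 1) * fact (p - i)) * (\<Prod>j\<in>{1..p} - {i}. M j)) \<and>
     ((\<forall>i\<in>{1..p}.
        \<beta> i = (\<Prod>j\<in>{1..<i}. M j / (M i - M j)) * (\<Prod>j\<in>{i<..p}. M j / (M j - M i)))
      \<longleftrightarrow> pure_resolution UNIV I) \<and>
     ((\<forall>i\<in>{1..p}.
        \<beta> i = (\<Prod>j\<in>{1..<i}. M j / (M i - M j)) * (\<Prod>j\<in>{i<..p}. M j / (M j - M i)) \<and>
        \<beta> i = 1 / (fact (i - 1) * fact (p - i)) * (\<Prod>j\<in>{1..p} - {i}. M j))
      \<longleftrightarrow> linear_resolution I {0}) \<and>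
     \<comment> \<open>(ii)\<close>
     (\<forall>i\<in>{1..p}.
        \<beta> i \<ge> (\<Prod>j\<in>{1..<i}. m j / (m i - m j)) * (\<Prod>j\<in>{i<..p}. m j / (m j - m i)) \<and>
        (\<Prod>j\<in>{1..<i}. m j / (m i - m j)) * (\<Prod>j\<in>{i<..p}. m j / (m j - m i))
          \<ge> (\<Prod>j\<in>{1..<i}. m j / (M i - m j)) * (\<Prod>j\<in>{i<..p}. m j / (M j - m i))) \<and>
     ((\<forall>i\<in>{1..p}.
        \<beta> i = (\<Prod>j\<in>{1..<i}. m j / (m i - m j)) * (\<Prod>j\<in>{i<..p}. m j / (m j - m i)) \<and>
        \<beta> i = (\<Prod>j\<in>{1..<i}. m j / (M i - m j)) * (\<Prod>j\<in>{i<..p}. m j / (M j - m i)))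
      \<longleftrightarrow> pure_resolution UNIV I)"
proof -
  obtain d where pos: "\<And>t. t < p \<Longrightarrow> d t > 0"
    and betti: "\<And>i j. betti i j UNIV I = subset_count d p i j"
    and bettiI: "\<And>i j. betti i j I {0} = subset_count d p (Suc i) j"
    and pd: "proj_dim UNIV I = p"
    using complete_intersection_betti[OF hom reg] unfolding p(1) I(1) by metis
  let ?S = "subset_sums d p"
  have S: "{j. betti i j UNIV I \<noteq> 0} = ?S i" for i
    by (simp only: betti subset_count_nonzero)
  have count: "subset_count d p i j \<noteq> 0 \<longleftrightarrow> j \<in> ?S i" for i j
    unfolding subset_count_nonzero[symmetric] by simp
  have S0: "?S 0 = {0}"
    unfolding subset_count_nonzero[symmetric] by (simp add: subset_count_0)
  have \<beta>_eq: "\<beta> i = real (p choose i)" for i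
    by (simp only: \<beta> total_betti_def betti subset_count_nonzero sum_subset_count)
  have M_eq: "M i = real_of_int (Max (?S i))" and m_eq: "m i = real_of_int (Min (?S i))" for i
    by (simp_all only: M m max_shift_def min_shift_def S)
  have M1: "d t \<le> Max (?S 1)" and m1: "Min (?S 1) \<le> d t" if "t < p" for t
    using subset_sums_1[OF that, of d] by (simp_all add: finite_subset_sums)

  have Mgap: "real k - real j \<le> M k - M j" if "j \<le> k" "k \<le> p" for j k
  proof (rule increasing_gap[OF _ that])
    fix i assume i: "i < p"
    have "Max (?S i) + 1 \<le> Max (?S (Suc i))"
      by (rule Max_subset_sums_Suc[OF i pos])
    then show "M i + 1 \<le> M (Suc i)"
      unfolding M_eq by linarith
  qed
  have mgap: "real k - real j \<le> m k - m j" if "j \<le> k" "k \<le> p" for j k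
  proof (rule increasing_gap[OF _ that])
    fix i assume i: "i < p"
    have "Min (?S i) + 1 \<le> Min (?S (Suc i))"
      by (rule Min_subset_sums_Suc[OF i pos])
    then show "m i + 1 \<le> m (Suc i)"
      unfolding m_eq by linarith
  qed
  have Mratio: "real j * M k \<le> real k * M j" if "1 \<le> j" "j \<le> k" "k \<le> p" for j k
  proof (rule decreasing_ratio[OF _ that])
    fix i assume "i < p"
    from Max_subset_sums_step[OF this, of d] show "real i * M (Suc i) \<le> real (Suc i) * M i"
      unfolding M_eq by (metis of_int_le_iff of_int_mult of_int_of_nat_eq)
  qed
  have mratio: "real k * m j \<le> real j * m k" if "1 \<le> j" "j \<le> k" "k \<le> p" for j k
  proof -
    have "real j * - m k \<le> real k * - m j"
    proof (rule decreasing_ratio[OF _ that])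
      fix i assume "i < p"
      from Min_subset_sums_step[OF this, of d] have "real (Suc i) * m i \<le> real i * m (Suc i)"
        unfolding m_eq by (metis of_int_le_iff of_int_mult of_int_of_nat_eq)
      then show "real i * - m (Suc i) \<le> real (Suc i) * - m i" by simp
    qed
    then show ?thesis by simp
  qed
  \<comment> \<open>The empty set gives the shift 0 in position 0, so the gaps from 0 to
    \<open>j\<close> yield \<open>M j >= j\<close> and \<open>m j >= j\<close>.\<close>
  have Mpos: "M j > 0" and mpos: "m j > 0" if "1 \<le> j" "j \<le> p" for j
    using Mgap[of 0 j] mgap[of 0 j] that by (simp_all add: M_eq m_eq S0)
  have mM: "m j \<le> M j" if "j \<le> p" for j
    unfolding M_eq m_eq of_int_le_iff
    using Max_ge[OF finite_subset_sums Min_in[OF finite_subset_sums subset_sums_nonempty[OF that]]] .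

  \<comment> \<open>Factors of the binomial coefficient (\<open>q\<close>), of the two upper bounds
    (\<open>a\<close>, \<open>u\<close>) and of the two lower bounds (\<open>b\<close>,
    \<open>l\<close>). They satisfy \<open>l <= b <= q <= a <= u\<close>.\<close>
  define q where "q i j = (if j < i then real j / (real i - real j) else real j / (real j - real i))" for i j
  define a where "a i j = (if j < i then M j / (M i - M j) else M j / (M j - M i))" for i j
  define u where "u i j = (if j < i then M j / (real i - real j) else M j / (real j - real i))" for i j
  define b where "b i j = (if j < i then m j / (m i - m j) else m j / (m j - m i))" for i j
  define l where "l i j = (if j < i then m j / (M i - m j) else m j / (M j - m i))" for i j
  let ?J = "\<lambda>i. {1..p} - {i}"
  have Q: "\<beta> i = prod (q i) (?J i)" if "i \<in> {1..p}" for i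
    unfolding \<beta>_eq binomial_prod[OF that] prod_split[OF that] q_def ..
  have A: "(\<Prod>j\<in>{1..<i}. M j / (M i - M j)) * (\<Prod>j\<in>{i<..p}. M j / (M j - M i)) = prod (a i) (?J i)"
    and B: "(\<Prod>j\<in>{1..<i}. m j / (m i - m j)) * (\<Prod>j\<in>{i<..p}. m j / (m j - m i)) = prod (b i) (?J i)"
    and L: "(\<Prod>j\<in>{1..<i}. m j / (M i - m j)) * (\<Prod>j\<in>{i<..p}. m j / (M j - m i)) = prod (l i) (?J i)"
    if "i \<in> {1..p}" for i
    unfolding prod_split[OF that] a_def b_def l_def by (rule refl)+
  have U: "1 / (fact (i - 1) * fact (p - i)) * (\<Prod>j\<in>{1..p} - {i}. M j) = prod (u i) (?J i)"
    if "i \<in> {1..p}" for i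
  proof -
    have "prod (u i) (?J i) = (\<Prod>j\<in>{1..<i}. M j / (real i - real j)) * (\<Prod>j\<in>{i<..p}. M j / (real j - real i))"
      unfolding prod_split[OF that] u_def ..
    also have "\<dots> = ((\<Prod>j\<in>{1..<i}. M j) * (\<Prod>j\<in>{i<..p}. M j)) / (fact (i - 1) * fact (p - i))"
      unfolding distance_prod[OF that, symmetric] by (simp add: prod_dividef)
    also have "(\<Prod>j\<in>{1..<i}. M j) * (\<Prod>j\<in>{i<..p}. M j) = (\<Prod>j\<in>{1..p} - {i}. M j)"
      unfolding prod_split[OF that] by simp
    finally show ?thesis by simp
  qed

  \<comment> \<open>For \<open>j < i\<close>, clearing denominators turns \<open>q <= a\<close> into
    \<open>j M_i <= i M_j\<close> and \<open>b <= q\<close> into \<open>i m_j <= j m_i\<close>. The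
    outer two inequalities compare denominators, by the gaps and by \<open>m <= M\<close>. Strict
    positivity of \<open>q\<close> and \<open>b\<close> is kept for
    \<open>prod_mono_eq\<close>.\<close>
  have qa: "0 < q i j \<and> q i j \<le> a i j" and au: "0 \<le> a i j \<and> a i j \<le> u i j"
    and bq: "0 < b i j \<and> b i j \<le> q i j" and lb: "0 \<le> l i j \<and> l i j \<le> b i j"
    if i: "i \<in> {1..p}" and j: "j \<in> ?J i" for i j
  proof -
    have j': "1 \<le> j" "j \<le> p" and i': "1 \<le> i" "i \<le> p" using i j by auto
    have "(0 < q i j \<and> q i j \<le> a i j) \<and> (0 \<le> a i j \<and> a i j \<le> u i j) \<and>
      (0 < b i j \<and> b i j \<le> q i j) \<and> (0 \<le> l i j \<and> l i j \<le> b i j)"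
    proof (cases "j < i")
      case True
      have g: "0 < real i - real j" "real i - real j \<le> M i - M j" "real i - real j \<le> m i - m j"
        using True Mgap[of j i] mgap[of j i] i' by auto
      have "real j * (M i - M j) \<le> (real i - real j) * M j" "(real i - real j) * m j \<le> real j * (m i - m j)"
        using Mratio[of j i] mratio[of j i] True i' j' by (auto simp: algebra_simps)
      with g have "real j / (real i - real j) \<le> M j / (M i - M j)" "m j / (m i - m j) \<le> real j / (real i - real j)"
        by (simp_all add: divide_le_eq le_divide_eq mult.commute)
      moreover have "M j / (M i - M j) \<le> M j / (real i - real j)" "m j / (M i - m j) \<le> m j / (m i - m j)"
        using g Mpos[OF j'] mpos[OF j'] mM[OF i'(2)] by (intro divide_left_mono; simp)+
      ultimately show ?thesis
        using True g Mpos[OF j'] mpos[OF j'] mM[OF i'(2)] j' by (simp add: q_def a_def u_def b_def l_def)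
    next
      case False
      then have ij: "i < j" using j by auto
      have g: "0 < real j - real i" "real j - real i \<le> M j - M i" "real j - real i \<le> m j - m i"
        using ij Mgap[of i j] mgap[of i j] j' by auto
      have "real j * (M j - M i) \<le> (real j - real i) * M j" "(real j - real i) * m j \<le> real j * (m j - m i)"
        using Mratio[of i j] mratio[of i j] ij i' j' by (auto simp: algebra_simps)
      with g have "real j / (real j - real i) \<le> M j / (M j - M i)" "m j / (m j - m i) \<le> real j / (real j - real i)"
        by (simp_all add: divide_le_eq le_divide_eq mult.commute)
      moreover have "M j / (M j - M i) \<le> M j / (real j - real i)" "m j / (M j - m i) \<le> m j / (m j - m i)"
        using g Mpos[OF j'] mpos[OF j'] mM[OF j'(2)] by (intro divide_left_mono; simp)+
      ultimately show ?thesis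
        using False g Mpos[OF j'] mpos[OF j'] mM[OF j'(2)] j' by (simp add: q_def a_def u_def b_def l_def)
    qed
    then show "0 < q i j \<and> q i j \<le> a i j" "0 \<le> a i j \<and> a i j \<le> u i j"
      "0 < b i j \<and> b i j \<le> q i j" "0 \<le> l i j \<and> l i j \<le> b i j" by blast+
  qed
  have ineqs: "\<beta> i \<le> prod (a i) (?J i)" "prod (a i) (?J i) \<le> prod (u i) (?J i)"
    "prod (b i) (?J i) \<le> \<beta> i" "prod (l i) (?J i) \<le> prod (b i) (?J i)" if "i \<in> {1..p}" for i
    unfolding Q[OF that]
    using prod_mono[of "?J i" "q i" "a i"] prod_mono[of "?J i" "a i" "u i"]
      prod_mono[of "?J i" "b i" "q i"] prod_mono[of "?J i" "l i" "b i"]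
      qa[OF that] au[OF that] bq[OF that] lb[OF that] by (meson less_imp_le)+

  \<comment> \<open>All equality cases are expressed through this condition; linearity adds the
    clause \<open>p = 1 \<or> d 0 = 1\<close>.\<close>
  define const where "const = (\<forall>s<p. d s = d 0)"
  let ?c = "real_of_int (d 0)"
  have c: "?c > 0"
    using pos[of 0] p(2) by simp
  have const_S: "?S i = {int i * d 0}" if const "i \<le> p" for i
    using subset_sums_const[of p d "d 0" i] that unfolding const_def by blast
  have const_Mm: "M i = real i * ?c" "m i = real i * ?c" if const "i \<le> p" for i
    using const_S[OF that] by (simp_all add: M_eq m_eq)
  have cancel: "x * ?c / (y * ?c - z * ?c) = x / (y - z)" for x y z
    using c by (simp flip: left_diff_distrib)
  have const_factor: "a i j = q i j" "b i j = q i j" "l i j = q i j" "u i j = ?c * q i j"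
    if const "i \<in> {1..p}" "j \<in> ?J i" for i j
  proof -
    have "M i = real i * ?c" "M j = real j * ?c" "m i = real i * ?c" "m j = real j * ?c"
      using const_Mm that by auto
    then show "a i j = q i j" "b i j = q i j" "l i j = q i j" "u i j = ?c * q i j"
      unfolding a_def b_def l_def u_def q_def by (simp_all add: cancel)
  qed
  have const_prods: "prod (a i) (?J i) = \<beta> i" "prod (b i) (?J i) = \<beta> i" "prod (l i) (?J i) = \<beta> i"
    "prod (u i) (?J i) = ?c ^ (p - 1) * \<beta> i" if const "i \<in> {1..p}" for i
  proof -
    show "prod (a i) (?J i) = \<beta> i" "prod (b i) (?J i) = \<beta> i" "prod (l i) (?J i) = \<beta> i"
      unfolding Q[OF that(2)] by (intro prod.cong refl const_factor(1-3)[OF that]; assumption)+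
    have "prod (u i) (?J i) = (\<Prod>j\<in>?J i. ?c * q i j)"
      by (rule prod.cong[OF refl const_factor(4)[OF that]])
    also have "\<dots> = ?c ^ (p - 1) * \<beta> i"
      using that(2) by (simp add: prod.distrib Q[OF that(2)] card_Diff_singleton)
    finally show "prod (u i) (?J i) = ?c ^ (p - 1) * \<beta> i" .
  qed
  \<comment> \<open>The only shift in position \<open>p\<close> is the sum of all degrees, so either
    equality makes every degree extremal. A single generator leaves nothing to compare.\<close>
  have extremal: "const" if "p \<ge> 2 \<Longrightarrow> M p = real p * M 1 \<or> m p = real p * m 1"
  proof (cases "p \<ge> 2")
    case True
    have full: "M p = real_of_int (sum d {..<p})" "m p = real_of_int (sum d {..<p})"
      by (simp_all add: M_eq m_eq subset_sums_full)
    have "\<exists>c. \<forall>s<p. d s = c"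
      using that[OF True]
    proof
      assume "M p = real p * M 1"
      then show ?thesis
        using max_sum_extremal[of d p "Max (?S 1)"] M1 unfolding full M_eq[of 1] by blast
    next
      assume "m p = real p * m 1"
      then show ?thesis
        using min_sum_extremal[of d p "Min (?S 1)"] m1 unfolding full m_eq[of 1] by blast
    qed
    then show ?thesis
      using p(2) unfolding const_def by auto
  next
    case False
    then show ?thesis
      using p(2) unfolding const_def by (metis less_2_cases less_one not_less le_less_trans less_numeral_extra(3) not_le zero_less_iff_neq_zero)
  qed
  have const_a: const if "\<And>i. i \<in> {1..p} \<Longrightarrow> \<beta> i = prod (a i) (?J i)"
  proof (rule extremal)
    assume "p \<ge> 2"
    then have one: "1 \<in> {1..p}" and pJ: "p \<in> ?J 1" by auto
    \<comment> \<open>Only \<open>i = 1\<close> and \<open>j = p\<close> are needed: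
      \<open>p / (p - 1) = M_p / (M_p - M_1)\<close> amounts to \<open>M_p = p M_1\<close>.\<close>
    have "q 1 p = a 1 p"
      by (rule prod_mono_eq[OF _ qa[OF one] that[OF one, unfolded Q[OF one]] pJ]) auto
    then show "M p = real p * M 1 \<or> m p = real p * m 1"
      using \<open>p \<ge> 2\<close> Mgap[of 1 p] by (simp add: q_def a_def field_simps)
  qed
  have const_b: const if "\<And>i. i \<in> {1..p} \<Longrightarrow> \<beta> i = prod (b i) (?J i)"
  proof (rule extremal)
    assume "p \<ge> 2"
    then have one: "1 \<in> {1..p}" and pJ: "p \<in> ?J 1" by auto
    have "b 1 p = q 1 p"
      by (rule prod_mono_eq[OF _ bq[OF one] that[OF one, unfolded Q[OF one], symmetric] pJ]) auto
    then show "M p = real p * M 1 \<or> m p = real p * m 1"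
      using \<open>p \<ge> 2\<close> mgap[of 1 p] by (simp add: q_def b_def field_simps)
  qed
  have pure: "pure_resolution UNIV I \<longleftrightarrow> const"
  proof
    assume "pure_resolution UNIV I"
    \<comment> \<open>Position 1 decides: its shifts are the degrees themselves.\<close>
    then have "\<exists>!j. j \<in> ?S 1"
      using p(2) unfolding pure_resolution_def pd betti count by auto
    moreover have "d t \<in> ?S 1" if "t < p" for t
      using subset_sums_1[OF that, of d] by simp
    ultimately show const
      using p(2) unfolding const_def by (metis One_nat_def Suc_le_lessD)
  next
    assume const
    then show "pure_resolution UNIV I"
      unfolding pure_resolution_def pd betti count using const_S by auto
  qed
  \<comment> \<open>Position \<open>i\<close> for \<open>I\<close> is position \<open>i + 1\<close>
    for \<open>S/I\<close>. Position 0 forces a common degree \<open>k\<close>; if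
    \<open>p >= 2\<close>, position 1 gives \<open>2 k = 1 + k\<close>.\<close>
  have linear: "linear_resolution I {0} \<longleftrightarrow> const \<and> (p = 1 \<or> d 0 = 1)"
  proof -
    have contra: "(j \<noteq> k \<longrightarrow> n = 0) \<longleftrightarrow> (n \<noteq> 0 \<longrightarrow> j = k)" for j k :: int and n :: nat
      by auto
    have lin: "linear_resolution I {0} \<longleftrightarrow> (\<exists>k. \<forall>i j. int i + j \<in> ?S (Suc i) \<longrightarrow> j = k)"
      unfolding linear_resolution_def bettiI count[symmetric] contra ..
    show ?thesis
    proof
      assume "linear_resolution I {0}"
      then obtain k where k: "\<And>i j. int i + j \<in> ?S (Suc i) \<Longrightarrow> j = k"
        unfolding lin by blast
      have dk: "d t = k" if "t < p" for t
        using k[of 0 "d t"] subset_sums_1[OF that, of d] by simp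
      then have const: const
        using p(2) unfolding const_def by simp
      moreover have "p = 1 \<or> d 0 = 1"
      proof (rule ccontr)
        assume "\<not> (p = 1 \<or> d 0 = 1)"
        then have "2 \<le> p" "d 0 \<noteq> 1" using p(2) by auto
        then have "?S (Suc 1) = {int (Suc 1) * d 0}"
          by (intro const_S[OF const]) simp
        then have "int 1 + (2 * d 0 - 1) \<in> ?S (Suc 1)" by simp
        from k[OF this] dk[of 0] p(2) \<open>d 0 \<noteq> 1\<close> show False by simp
      qed
      ultimately show "const \<and> (p = 1 \<or> d 0 = 1)" ..
    next
      assume *: "const \<and> (p = 1 \<or> d 0 = 1)"
      have "j = d 0" if "int i + j \<in> ?S (Suc i)" for i j
      proof -
        have i: "Suc i \<le> p"
        proof (rule ccontr)
          assume "\<not> Suc i \<le> p"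
          then have "?S (Suc i) = {}"
            by (intro subset_sums_empty) simp
          with that show False by simp
        qed
        have "?S (Suc i) = {int (Suc i) * d 0}"
          using * i by (intro const_S) auto
        with that have j: "int i + j = int (Suc i) * d 0" by simp
        from * show ?thesis
        proof (elim conjE disjE)
          assume "p = 1"
          then have "i = 0" using i by simp
          with j show ?thesis by simp
        next
          assume "d 0 = 1"
          with j show ?thesis by simp
        qed
      qed
      then show "linear_resolution I {0}"
        unfolding lin by blast
    qed
  qed
  have \<beta>_pos: "\<beta> i > 0" if "i \<in> {1..p}" for i
    using that by (simp add: \<beta>_eq)
  \<comment> \<open>Under \<open>const\<close> each of the \<open>p - 1\<close> factors of
    \<open>u\<close> is \<open>d 0\<close> times that of \<open>q\<close>, so equality means
    \<open>d 0 ^ (p - 1) = 1\<close>.\<close>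
  have u_iff: "(\<forall>i\<in>{1..p}. \<beta> i = prod (u i) (?J i)) \<longleftrightarrow> p = 1 \<or> d 0 = 1" if const
  proof -
    have "\<beta> i = prod (u i) (?J i) \<longleftrightarrow> ?c ^ (p - 1) = 1" if i: "i \<in> {1..p}" for i
      using \<beta>_pos[OF i] unfolding const_prods(4)[OF \<open>const\<close> i] by auto
    moreover have "?c ^ (p - 1) = 1 \<longleftrightarrow> p = 1 \<or> d 0 = 1"
      using c p(2) power_eq_1_iff[of ?c "p - 1"] by auto
    moreover have "1 \<in> {1..p}"
      using p(2) by simp
    ultimately show ?thesis by blast
  qed

  have eq1: "(\<forall>i\<in>{1..p}. \<beta> i = prod (a i) (?J i)) \<longleftrightarrow> pure_resolution UNIV I"
    unfolding pure using const_a const_prods(1) by force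
  \<comment> \<open>The first equalities yield \<open>const\<close>, under which
    \<open>u_iff\<close> evaluates the second ones.\<close>
  have eq2: "(\<forall>i\<in>{1..p}. \<beta> i = prod (a i) (?J i) \<and> \<beta> i = prod (u i) (?J i)) \<longleftrightarrow> linear_resolution I {0}"
    unfolding linear ball_conj_distrib using eq1[unfolded pure] u_iff by blast
  have eq3: "(\<forall>i\<in>{1..p}. \<beta> i = prod (b i) (?J i) \<and> \<beta> i = prod (l i) (?J i)) \<longleftrightarrow> pure_resolution UNIV I"
    unfolding pure ball_conj_distrib using const_b const_prods(2,3) by force
  show ?thesis
    using pd ineqs eq1 eq2 eq3 by (simp only: A B L U cong: ball_cong) simp
qed

end
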